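(* Let $1\le p<\infty$, let $d_{w,p}$ be a Lorentz sequence space and let $T\in L(d_{w,p})$. If $T$ is not strictly singular, then $J^{\ell_p}\subseteq J_T$.
   Context: Let $1\le p<\infty$ and let $w=(w_n)$ be a real sequence with $w_1=1$, $w_n\downarrow 0$ and $\sum_n w_n=\infty$. The Lorentz sequence space $d_{w,p}$ is the Banach space of all $x=(x_n)\in c_0$ with $\|x\|_{d_{w,p}}=\big(\sum_{n}w_n (x^*_n)^p\big)^{1/p}<\infty$, where $(x^*_n)$ is the non-increasing rearrangement of $(|x_n|)$. An operator is strictly singular if its restriction to no infinite-dimensional closed subspace is an isomorphism. $J_T=\{\sum_{i=1}^n A_iTB_i: n\in\mathbb N, A_i,B_i\in L(d_{w,p})\}$ is the ideal generated by $T$. $J^{\ell_p}$ is the set of operators $S\in L(d_{w,p})$ of the form $S=BA$ with $A\in L(d_{w,p},\ell_p)$, $B\in L(\ell_p,d_{w,p})$. *)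

theory Defs
  imports "HOL-Analysis.Analysis"
begin

text \<open>Sequences are functions nat => real (real scalars); indices start at 0,
  so the paper's w_1 is w 0 here.\<close>

definition lorentz_weight :: "(nat \<Rightarrow> real) \<Rightarrow> bool" where
  "lorentz_weight w \<longleftrightarrow> w 0 = 1 \<and> (\<forall>n. w (Suc n) \<le> w n) \<and> w \<longlonglongrightarrow> 0 \<and> \<not> summable w"

text \<open>Non-increasing rearrangement of (|x n|) (0-indexed): the n-th entry is the least
  s >= 0 such that at most n entries of |x| exceed s.\<close>
definition drearr :: "(nat \<Rightarrow> real) \<Rightarrow> nat \<Rightarrow> real" where
  "drearr x n = Inf {s. 0 \<le> s \<and> finite {k. \<bar>x k\<bar> > s} \<and> card {k. \<bar>x k\<bar> > s} \<le> n}"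

definition in_dwp :: "(nat \<Rightarrow> real) \<Rightarrow> real \<Rightarrow> (nat \<Rightarrow> real) \<Rightarrow> bool" where
  "in_dwp w p x \<longleftrightarrow> x \<longlonglongrightarrow> 0 \<and> summable (\<lambda>n. w n * drearr x n powr p)"

definition norm_dwp :: "(nat \<Rightarrow> real) \<Rightarrow> real \<Rightarrow> (nat \<Rightarrow> real) \<Rightarrow> real" where
  "norm_dwp w p x = (\<Sum>n. w n * drearr x n powr p) powr (1 / p)"

definition in_lp :: "real \<Rightarrow> (nat \<Rightarrow> real) \<Rightarrow> bool" where
  "in_lp p x \<longleftrightarrow> summable (\<lambda>n. \<bar>x n\<bar> powr p)"

definition norm_lp :: "real \<Rightarrow> (nat \<Rightarrow> real) \<Rightarrow> real" where
  "norm_lp p x = (\<Sum>n. \<bar>x n\<bar> powr p) powr (1 / p)"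

text \<open>Bounded linear operator between sequence spaces given by a carrier predicate and a norm;
  operators are only considered on the carrier.\<close>
definition bounded_op ::
  "((nat \<Rightarrow> real) \<Rightarrow> bool) \<Rightarrow> ((nat \<Rightarrow> real) \<Rightarrow> real) \<Rightarrow>
   ((nat \<Rightarrow> real) \<Rightarrow> bool) \<Rightarrow> ((nat \<Rightarrow> real) \<Rightarrow> real) \<Rightarrow>
   ((nat \<Rightarrow> real) \<Rightarrow> (nat \<Rightarrow> real)) \<Rightarrow> bool" where
  "bounded_op X nX Y nY T \<longleftrightarrow>
     (\<forall>x. X x \<longrightarrow> Y (T x)) \<and>
     (\<forall>x y. X x \<longrightarrow> X y \<longrightarrow> T (\<lambda>k. x k + y k) = (\<lambda>k. T x k + T y k)) \<and>
     (\<forall>c x. X x \<longrightarrow> T (\<lambda>k. c * x k) = (\<lambda>k. c * T x k)) \<and>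
     (\<exists>C. \<forall>x. X x \<longrightarrow> nY (T x) \<le> C * nX x)"

definition L_dwp :: "(nat \<Rightarrow> real) \<Rightarrow> real \<Rightarrow> ((nat \<Rightarrow> real) \<Rightarrow> (nat \<Rightarrow> real)) set" where
  "L_dwp w p = {T. bounded_op (in_dwp w p) (norm_dwp w p) (in_dwp w p) (norm_dwp w p) T}"

definition closed_subspace_dwp :: "(nat \<Rightarrow> real) \<Rightarrow> real \<Rightarrow> (nat \<Rightarrow> real) set \<Rightarrow> bool" where
  "closed_subspace_dwp w p Y \<longleftrightarrow>
     (\<forall>y\<in>Y. in_dwp w p y) \<and> (\<lambda>k. 0) \<in> Y \<and>
     (\<forall>x\<in>Y. \<forall>y\<in>Y. (\<lambda>k. x k + y k) \<in> Y) \<and>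
     (\<forall>c. \<forall>x\<in>Y. (\<lambda>k. c * x k) \<in> Y) \<and>
     (\<forall>ys y. (\<forall>j. ys j \<in> Y) \<longrightarrow> in_dwp w p y \<longrightarrow>
        (\<lambda>j. norm_dwp w p (\<lambda>k. ys j k - y k)) \<longlonglongrightarrow> 0 \<longrightarrow> y \<in> Y)"

definition infinite_dim :: "(nat \<Rightarrow> real) set \<Rightarrow> bool" where
  "infinite_dim Y \<longleftrightarrow>
     (\<forall>n::nat. \<exists>f :: nat \<Rightarrow> (nat \<Rightarrow> real). (\<forall>i<n. f i \<in> Y) \<and>
        (\<forall>c. (\<lambda>k. \<Sum>i<n. c i * f i k) = (\<lambda>k. 0) \<longrightarrow> (\<forall>i<n. c i = 0)))"

text \<open>T restricted to Y is an isomorphism (onto its image): bounded below on Y.\<close>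
definition strictly_singular_dwp ::
  "(nat \<Rightarrow> real) \<Rightarrow> real \<Rightarrow> ((nat \<Rightarrow> real) \<Rightarrow> (nat \<Rightarrow> real)) \<Rightarrow> bool" where
  "strictly_singular_dwp w p T \<longleftrightarrow>
     \<not> (\<exists>Y. closed_subspace_dwp w p Y \<and> infinite_dim Y \<and>
          (\<exists>c>0. \<forall>y\<in>Y. c * norm_dwp w p y \<le> norm_dwp w p (T y)))"

definition ideal_gen ::
  "(nat \<Rightarrow> real) \<Rightarrow> real \<Rightarrow> ((nat \<Rightarrow> real) \<Rightarrow> (nat \<Rightarrow> real)) \<Rightarrow>
   ((nat \<Rightarrow> real) \<Rightarrow> (nat \<Rightarrow> real)) set" where
  "ideal_gen w p T = {S. \<exists>(n::nat) A B. (\<forall>i<n. A i \<in> L_dwp w p \<and> B i \<in> L_dwp w p) \<and>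
      (\<forall>x. in_dwp w p x \<longrightarrow> S x = (\<lambda>k. \<Sum>i<n. A i (T (B i x)) k))}"

definition J_lp :: "(nat \<Rightarrow> real) \<Rightarrow> real \<Rightarrow> ((nat \<Rightarrow> real) \<Rightarrow> (nat \<Rightarrow> real)) set" where
  "J_lp w p = {S. \<exists>A B. bounded_op (in_dwp w p) (norm_dwp w p) (in_lp p) (norm_lp p) A \<and>
      bounded_op (in_lp p) (norm_lp p) (in_dwp w p) (norm_dwp w p) B \<and>
      (\<forall>x. in_dwp w p x \<longrightarrow> S x = B (A x))}"

end

theory Submission
  imports Defs
begin

text \<open>Let \<open>T\<close> be bounded below on \<open>Y\<close>. Since \<open>Y\<close> is infinite-dimensional it contains
  nonzero \<open>y\<close> such that \<open>y\<close> and \<open>T y\<close> both vanish on any prescribed initial segment.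
  Adding up such vectors gives normalized images \<open>T y\<close> of arbitrarily small sup norm, because
  the weight is not summable. A normalized \<open>z = T y\<close> with small entries carries most of its norm
  on large ranks, so a gliding hump yields \<open>z j = T (y j)\<close> whose main parts live on disjoint sets of
  coordinates and of ranks. Then \<open>x \<mapsto> \<Sum>j. x j * y j\<close> is bounded from \<open>\<ell>\<^sub>p\<close> to the
  Lorentz space by an upper \<open>p\<close>-estimate, and the functionals averaging \<open>x k / z j k\<close> over the
  \<open>j\<close>-th block map the Lorentz space boundedly into \<open>\<ell>\<^sub>p\<close>. Composed with \<open>T\<close>
  in between, they give a lower triangular matrix with unit diagonal and small columns, which forward
  substitution inverts on \<open>\<ell>\<^sub>p\<close>. So the identity of \<open>\<ell>\<^sub>p\<close> factors through
  \<open>T\<close>, and every operator factoring through \<open>\<ell>\<^sub>p\<close> lies in the ideal of \<open>T\<close>.\<close>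

subsection \<open>The Lorentz norm as a supremum over matchings\<close>

text \<open>Only finitely many entries of a null sequence reach the modulus of a given nonzero
  entry, so the maximum is taken over a finite set.\<close>

lemma ex_max_outside_finite:
  fixes x :: "nat \<Rightarrow> real"
  assumes "x \<longlonglongrightarrow> 0" and "finite S"
  shows "\<exists>k. k \<notin> S \<and> (\<forall>j. j \<notin> S \<longrightarrow> \<bar>x j\<bar> \<le> \<bar>x k\<bar>)"
proof (cases "\<forall>j. j \<notin> S \<longrightarrow> x j = 0")
  case True
  obtain k where "k \<notin> S" using ex_new_if_finite[OF infinite_UNIV_nat assms(2)] by auto
  then show ?thesis using True by auto
next
  case False
  then obtain j0 where j0: "j0 \<notin> S" "x j0 \<noteq> 0" by auto
  define G where "G = {j. j \<notin> S \<and> \<bar>x j\<bar> \<ge> \<bar>x j0\<bar>}"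
  have "\<forall>\<^sub>F j in sequentially. \<bar>x j\<bar> < \<bar>x j0\<bar>"
    using order_tendstoD(2)[OF tendsto_rabs_zero[OF assms(1)], of "\<bar>x j0\<bar>"] j0 by simp
  then obtain K where K: "\<And>j. j \<ge> K \<Longrightarrow> \<bar>x j\<bar> < \<bar>x j0\<bar>"
    by (auto simp: eventually_sequentially)
  have "G \<subseteq> {..<K}" using K unfolding G_def by (auto simp: not_le[symmetric])
  then have fG: "finite G" by (rule finite_subset) simp
  have jG: "j0 \<in> G" using j0 by (simp add: G_def)
  have "Max ((\<lambda>j. \<bar>x j\<bar>) ` G) \<in> (\<lambda>j. \<bar>x j\<bar>) ` G" using fG jG by (intro Max_in) auto
  then obtain k where k: "k \<in> G" "\<bar>x k\<bar> = Max ((\<lambda>j. \<bar>x j\<bar>) ` G)" by auto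
  have "\<bar>x j\<bar> \<le> \<bar>x k\<bar>" if "j \<notin> S" for j
  proof (cases "j \<in> G")
    case True then show ?thesis using k fG by simp
  next
    case False then show ?thesis using that k(1) by (auto simp: G_def)
  qed
  then show ?thesis using k(1) by (auto simp: G_def)
qed

text \<open>Repeatedly pick a largest remaining entry. The enumeration need not be onto: if
  infinitely many entries are nonzero, the zero entries are never reached.\<close>

lemma greedy_enumeration:
  fixes x :: "nat \<Rightarrow> real"
  assumes "x \<longlonglongrightarrow> 0"
  obtains \<sigma> :: "nat \<Rightarrow> nat" where "inj \<sigma>"
    and "\<And>n k. k \<notin> \<sigma> ` {..<n} \<Longrightarrow> \<bar>x k\<bar> \<le> \<bar>x (\<sigma> n)\<bar>"
proof -
  \<comment> \<open>A state consists of the finite set of coordinates listed so far and the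
    coordinate listed next.\<close>
  define P where "P n s \<longleftrightarrow> finite (fst s) \<and> snd s \<notin> fst s \<and>
      (\<forall>j. j \<notin> fst s \<longrightarrow> \<bar>x j\<bar> \<le> \<bar>x (snd s)\<bar>) \<and> (n = 0 \<longrightarrow> fst s = {})"
    for n :: nat and s :: "nat set \<times> nat"
  define Q where "Q n s t \<longleftrightarrow> fst t = insert (snd s) (fst s)" for n :: nat and s t :: "nat set \<times> nat"
  have "\<exists>f. \<forall>n. P n (f n) \<and> Q n (f n) (f (Suc n))"
  proof (rule dependent_nat_choice)
    show "\<exists>s. P 0 s"
      using ex_max_outside_finite[OF assms, of "{}"] by (auto simp: P_def)
  next
    fix s n assume "P n s"
    then have fin: "finite (insert (snd s) (fst s))" by (simp add: P_def)
    from ex_max_outside_finite[OF assms this] obtain k where "k \<notin> insert (snd s) (fst s)"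
      "\<forall>j. j \<notin> insert (snd s) (fst s) \<longrightarrow> \<bar>x j\<bar> \<le> \<bar>x k\<bar>" by blast
    with fin have "P (Suc n) (insert (snd s) (fst s), k) \<and> Q n s (insert (snd s) (fst s), k)"
      unfolding P_def Q_def by simp
    then show "\<exists>t. P (Suc n) t \<and> Q n s t" by blast
  qed
  then obtain f where f: "\<And>n. P n (f n)" "\<And>n. Q n (f n) (f (Suc n))" by auto
  define \<sigma> where "\<sigma> n = snd (f n)" for n
  have S: "fst (f n) = \<sigma> ` {..<n}" for n
  proof (induction n)
    case 0 then show ?case using f(1)[of 0] by (simp add: P_def)
  next
    case (Suc n) then show ?case using f(2)[of n] by (simp add: Q_def \<sigma>_def lessThan_Suc)
  qed
  have "snd (f n) \<notin> fst (f n)" for n using f(1)[of n] by (simp add: P_def)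
  then have "\<sigma> n \<notin> \<sigma> ` {..<n}" for n unfolding S \<sigma>_def[symmetric] .
  then have "\<sigma> i \<noteq> \<sigma> j" if "i < j" for i j using that by (metis imageI lessThan_iff)
  then have "inj \<sigma>" unfolding inj_def by (metis linorder_neqE_nat)
  moreover have "\<bar>x k\<bar> \<le> \<bar>x (\<sigma> n)\<bar>" if "k \<notin> \<sigma> ` {..<n}" for n k
  proof -
    have "\<forall>j. j \<notin> fst (f n) \<longrightarrow> \<bar>x j\<bar> \<le> \<bar>x (snd (f n))\<bar>" using f(1)[of n] by (simp add: P_def)
    then show ?thesis using that unfolding S \<sigma>_def[symmetric] by blast
  qed
  ultimately show ?thesis using that by blast
qed

text \<open>The infimum is a minimum: entries exceeding \<open>\<bar>x (\<sigma> n)\<bar>\<close>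
  are among the first \<open>n\<close> picks, while any smaller threshold is exceeded by the first
  \<open>n + 1\<close> picks.\<close>

lemma drearr_greedy:
  fixes x :: "nat \<Rightarrow> real"
  assumes "inj \<sigma>" and greedy: "\<And>n k. k \<notin> \<sigma> ` {..<n} \<Longrightarrow> \<bar>x k\<bar> \<le> \<bar>x (\<sigma> n)\<bar>"
  shows "drearr x n = \<bar>x (\<sigma> n)\<bar>"
  unfolding drearr_def
proof (rule cInf_eq_minimum)
  have sub: "{k. \<bar>x k\<bar> > \<bar>x (\<sigma> n)\<bar>} \<subseteq> \<sigma> ` {..<n}" using greedy[of _ n] by force
  have "card (\<sigma> ` {..<n}) \<le> n" using card_image_le[of "{..<n}" \<sigma>] by simp
  then show "\<bar>x (\<sigma> n)\<bar> \<in> {s. 0 \<le> s \<and> finite {k. s < \<bar>x k\<bar>} \<and> card {k. s < \<bar>x k\<bar>} \<le> n}"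
    using finite_subset[OF sub] card_mono[OF _ sub] by auto
next
  fix s assume s: "s \<in> {s. 0 \<le> s \<and> finite {k. s < \<bar>x k\<bar>} \<and> card {k. s < \<bar>x k\<bar>} \<le> n}"
  show "\<bar>x (\<sigma> n)\<bar> \<le> s"
  proof (rule ccontr)
    assume "\<not> \<bar>x (\<sigma> n)\<bar> \<le> s"
    moreover have "\<bar>x (\<sigma> n)\<bar> \<le> \<bar>x (\<sigma> i)\<bar>" if "i \<le> n" for i
      using that assms(1) by (intro greedy) (auto simp: inj_eq)
    ultimately have "\<sigma> ` {..n} \<subseteq> {k. s < \<bar>x k\<bar>}" by force
    then have "card (\<sigma> ` {..n}) \<le> n" using s card_mono[of "{k. s < \<bar>x k\<bar>}" "\<sigma> ` {..n}"] by auto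
    moreover have "card (\<sigma> ` {..n}) = Suc n" using card_image[OF inj_on_subset[OF assms(1)], of "{..n}"] by simp
    ultimately show False by simp
  qed
qed

lemma drearr_attained:
  fixes x :: "nat \<Rightarrow> real"
  assumes "x \<longlonglongrightarrow> 0"
  obtains \<sigma> :: "nat \<Rightarrow> nat" where "inj \<sigma>"
    and "\<And>n k. k \<notin> \<sigma> ` {..<n} \<Longrightarrow> \<bar>x k\<bar> \<le> \<bar>x (\<sigma> n)\<bar>" and "\<And>n. drearr x n = \<bar>x (\<sigma> n)\<bar>"
  using greedy_enumeration[OF assms] drearr_greedy by metis

text \<open>Exchange argument: if \<open>G\<close> is not contained in the first \<open>N\<close>
  picks, one of its elements is dominated by the next pick and can be removed.\<close>

lemma sum_le_greedy:
  fixes a :: "nat \<Rightarrow> real"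
  assumes "inj \<sigma>" and "\<And>n k. k \<notin> \<sigma> ` {..<n} \<Longrightarrow> a k \<le> a (\<sigma> n)" and nn: "\<And>k. 0 \<le> a k"
    and "finite G" and "card G \<le> N"
  shows "sum a G \<le> (\<Sum>n<N. a (\<sigma> n))"
  using assms(4,5)
proof (induction N arbitrary: G)
  case 0 then show ?case by simp
next
  case (Suc N)
  show ?case
  proof (cases "G \<subseteq> \<sigma> ` {..<N}")
    case True
    then have "sum a G \<le> sum a (\<sigma> ` {..<N})" using nn by (intro sum_mono2) auto
    also have "\<dots> = (\<Sum>n<N. a (\<sigma> n))" using inj_on_subset[OF assms(1)] by (subst sum.reindex) auto
    finally show ?thesis using nn[of "\<sigma> N"] by simp
  next
    case False
    then obtain k where k: "k \<in> G" "k \<notin> \<sigma> ` {..<N}" by auto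
    have "sum a (G - {k}) \<le> (\<Sum>n<N. a (\<sigma> n))" using Suc k by (intro Suc.IH) auto
    moreover have "sum a G = a k + sum a (G - {k})" using Suc.prems k by (simp add: sum.remove)
    ultimately show ?thesis using assms(2)[OF k(2)] by simp
  qed
qed

text \<open>A pair \<open>(k, n)\<close> matches the coordinate \<open>k\<close> with the rank \<open>n\<close>. The \<open>p\<close>-th power of the Lorentz
  norm is the supremum of the weighted sums \<open>wsum\<close> over all matchings, which replaces
  the rearrangement in all estimates.\<close>

definition matching :: "(nat \<times> nat) set \<Rightarrow> bool" where
  "matching P \<longleftrightarrow> finite P \<and> inj_on fst P \<and> inj_on snd P"

definition wsum :: "(nat \<Rightarrow> real) \<Rightarrow> real \<Rightarrow> (nat \<times> nat) set \<Rightarrow> (nat \<Rightarrow> real) \<Rightarrow> real" where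
  "wsum w p P x = (\<Sum>q\<in>P. w (snd q) * \<bar>x (fst q)\<bar> powr p)"

definition norm_pow :: "(nat \<Rightarrow> real) \<Rightarrow> real \<Rightarrow> (nat \<Rightarrow> real) \<Rightarrow> real" where
  "norm_pow w p x = (\<Sum>n. w n * drearr x n powr p)"

lemma matching_subset: "matching P \<Longrightarrow> Q \<subseteq> P \<Longrightarrow> matching Q"
  unfolding matching_def by (meson finite_subset inj_on_subset)

lemma matching_graph:
  assumes "inj_on h I" and "finite I"
  shows "matching ((\<lambda>i. (h i, i)) ` I)"
  using assms unfolding matching_def by (auto simp: inj_on_def)

lemma wsum_graph: "wsum w p ((\<lambda>i. (h i, i)) ` I) x = (\<Sum>i\<in>I. w i * \<bar>x (h i)\<bar> powr p)"
  unfolding wsum_def by (subst sum.reindex) (auto simp: inj_on_def)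

text \<open>A rearrangement inequality, proved by Abel summation: an antitone weight is a sum of
  constant weights on initial segments, and each of these is handled by
  \<open>sum_le_greedy\<close>.\<close>

lemma matching_sum_le_greedy:
  fixes a :: "nat \<Rightarrow> real" and w :: "nat \<Rightarrow> real"
  assumes "inj \<sigma>" and "\<And>n k. k \<notin> \<sigma> ` {..<n} \<Longrightarrow> a k \<le> a (\<sigma> n)" and nn: "\<And>k. 0 \<le> a k"
    and "antimono w" and "\<And>n. 0 \<le> w n"
    and "matching P" and "snd ` P \<subseteq> {..<N}"
  shows "(\<Sum>q\<in>P. w (snd q) * a (fst q)) \<le> (\<Sum>n<N. w n * a (\<sigma> n))"
  using assms(4-7)
proof (induction N arbitrary: w P)
  case 0 then show ?case by simp
next
  case (Suc N)
  \<comment> \<open>Split off the constant weight \<open>w N\<close>; the remaining weight vanishes at rank \<open>N\<close>.\<close>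
  define v where "v n = w (min n N) - w N" for n
  have fin: "finite P" using Suc.prems by (simp add: matching_def)
  have "antimono v" using Suc.prems(1) by (auto simp: v_def monotone_def min_def)
  moreover have "0 \<le> v n" for n using Suc.prems(1) by (auto simp: v_def monotone_def)
  moreover have "matching {q \<in> P. snd q < N}" using Suc.prems(3) by (rule matching_subset) auto
  moreover have v0: "v n = 0" if "N \<le> n" for n using that by (simp add: v_def min_absorb2)
  ultimately have 1: "(\<Sum>q\<in>{q \<in> P. snd q < N}. v (snd q) * a (fst q)) \<le> (\<Sum>n<N. v n * a (\<sigma> n))"
    using Suc.IH[of v "{q \<in> P. snd q < N}"] by auto
  have v1: "w n = v n + w N" if "n \<le> N" for n using that by (simp add: v_def min_absorb1)
  have 2: "(\<Sum>q\<in>{q \<in> P. snd q < N}. v (snd q) * a (fst q)) = (\<Sum>q\<in>P. v (snd q) * a (fst q))"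
    using fin by (intro sum.mono_neutral_left) (auto simp: v0 not_less)
  have "card (fst ` P) = card (snd ` P)"
    using Suc.prems(3) by (simp add: matching_def card_image)
  also have "\<dots> \<le> Suc N" using card_mono[OF _ Suc.prems(4)] by simp
  finally have "sum a (fst ` P) \<le> (\<Sum>n<Suc N. a (\<sigma> n))"
    using fin by (intro sum_le_greedy[where a = a and \<sigma> = \<sigma>] assms(1-3)) auto
  then have 3: "(\<Sum>q\<in>P. a (fst q)) \<le> (\<Sum>n<Suc N. a (\<sigma> n))"
    using Suc.prems(3) by (simp add: matching_def sum.reindex)
  have "(\<Sum>q\<in>P. w (snd q) * a (fst q)) = (\<Sum>q\<in>P. v (snd q) * a (fst q) + w N * a (fst q))"
  proof (intro sum.cong refl)
    fix q assume "q \<in> P"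
    then have "snd q \<le> N" using Suc.prems(4) by fastforce
    then show "w (snd q) * a (fst q) = v (snd q) * a (fst q) + w N * a (fst q)"
      by (subst v1) (auto simp: distrib_right)
  qed
  also have "\<dots> = (\<Sum>q\<in>P. v (snd q) * a (fst q)) + w N * (\<Sum>q\<in>P. a (fst q))"
    by (simp add: sum.distrib sum_distrib_left)
  also have "\<dots> \<le> (\<Sum>n<N. v n * a (\<sigma> n)) + w N * (\<Sum>n<Suc N. a (\<sigma> n))"
    using 1 2 3 Suc.prems(2) by (intro add_mono mult_left_mono) auto
  also have "(\<Sum>n<N. v n * a (\<sigma> n)) = (\<Sum>n<Suc N. v n * a (\<sigma> n))" by (simp add: v0)
  also have "(\<Sum>n<Suc N. v n * a (\<sigma> n)) + w N * (\<Sum>n<Suc N. a (\<sigma> n)) = (\<Sum>n<Suc N. v n * a (\<sigma> n) + w N * a (\<sigma> n))"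
    by (simp only: sum.distrib sum_distrib_left)
  also have "\<dots> = (\<Sum>n<Suc N. w n * a (\<sigma> n))"
    by (intro sum.cong refl) (simp add: distrib_right[symmetric] v1[symmetric])
  finally show ?case .
qed

section \<open>Basic estimates for the Lorentz norm\<close>

locale lorentz =
  fixes w :: "nat \<Rightarrow> real" and p :: real
  assumes p_ge_1: "1 \<le> p" and weight: "lorentz_weight w"
begin

lemma w_antimono: "antimono w"
  using weight by (auto simp: lorentz_weight_def intro: decseq_SucI)

lemma w_nonneg: "0 \<le> w n"
  using decseq_ge[OF w_antimono] weight by (auto simp: lorentz_weight_def)

lemma w_0: "w 0 = 1"
  using weight by (simp add: lorentz_weight_def)

lemma w_le_1: "w n \<le> 1"
  using w_antimono w_0 by (metis antimonoD le0)

lemma wsum_nonneg: "0 \<le> wsum w p P x"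
  unfolding wsum_def using w_nonneg by (intro sum_nonneg) auto

lemma norm_pow_nonneg: "in_dwp w p x \<Longrightarrow> 0 \<le> norm_pow w p x"
  unfolding norm_pow_def in_dwp_def using w_nonneg by (auto intro!: suminf_nonneg)

lemma norm_dwp_eq: "norm_dwp w p x = norm_pow w p x powr (1/p)"
  by (simp add: norm_dwp_def norm_pow_def)

lemma norm_pow_eq: "in_dwp w p x \<Longrightarrow> norm_pow w p x = norm_dwp w p x powr p"
  using p_ge_1 norm_pow_nonneg by (simp add: norm_dwp_eq powr_powr)

text \<open>The greedy matching beats \<open>P\<close> on the first \<open>N\<close> ranks, and its
  sum is a partial sum of the norm series.\<close>

lemma wsum_le_norm_pow:
  assumes "in_dwp w p x" and "matching P"
  shows "wsum w p P x \<le> norm_pow w p x"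
proof -
  have x: "x \<longlonglongrightarrow> 0" and sm: "summable (\<lambda>n. w n * drearr x n powr p)"
    using assms(1) by (auto simp: in_dwp_def)
  obtain \<sigma> where \<sigma>: "inj \<sigma>" "\<And>n k. k \<notin> \<sigma> ` {..<n} \<Longrightarrow> \<bar>x k\<bar> \<le> \<bar>x (\<sigma> n)\<bar>"
    "\<And>n. drearr x n = \<bar>x (\<sigma> n)\<bar>" using drearr_attained[OF x] by metis
  have "finite (snd ` P)" using assms(2) by (simp add: matching_def)
  then obtain N where N: "snd ` P \<subseteq> {..<N}" using finite_nat_iff_bounded by blast
  have "wsum w p P x \<le> (\<Sum>n<N. w n * \<bar>x (\<sigma> n)\<bar> powr p)"
    unfolding wsum_def using \<sigma> p_ge_1
    by (intro matching_sum_le_greedy[where a = "\<lambda>k. \<bar>x k\<bar> powr p"] powr_mono2 w_antimono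
        w_nonneg assms(2) N) auto
  also have "\<dots> \<le> norm_pow w p x"
    unfolding norm_pow_def \<sigma>(3)[symmetric] using sm w_nonneg by (intro sum_le_suminf) auto
  finally show ?thesis .
qed

text \<open>Boundedness of the matching sums already forces \<open>x\<close> to be a null sequence, because
  the weight is not summable.\<close>

lemma in_dwpI:
  assumes bound: "\<And>P. matching P \<Longrightarrow> wsum w p P x \<le> B"
  shows "in_dwp w p x" and "norm_pow w p x \<le> B"
proof -
  have fin: "finite {k. e \<le> \<bar>x k\<bar>}" if "e > 0" for e
  proof (rule ccontr)
    \<comment> \<open>Infinitely many such entries can be matched with arbitrarily many ranks, which
      bounds the partial sums of \<open>w\<close>.\<close>
    assume inf: "infinite {k. e \<le> \<bar>x k\<bar>}"
    have "(\<Sum>i<n. w i) \<le> B / e powr p" for n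
    proof -
      obtain h :: "nat \<Rightarrow> nat" where h: "inj h" "range h \<subseteq> {k. e \<le> \<bar>x k\<bar>}"
        using inf by (auto simp: infinite_iff_countable_subset)
      have "e powr p * (\<Sum>i<n. w i) \<le> (\<Sum>i<n. w i * \<bar>x (h i)\<bar> powr p)"
        unfolding sum_distrib_left using h(2) w_nonneg that p_ge_1
        by (intro sum_mono) (subst mult.commute, rule mult_left_mono, auto intro!: powr_mono2)
      also have "\<dots> \<le> B"
        using bound[OF matching_graph[OF inj_on_subset[OF h(1)], of "{..<n}"]] by (simp add: wsum_graph)
      finally show ?thesis using that by (simp add: field_simps)
    qed
    then have "summable w" using w_nonneg by (intro bounded_imp_summable[where B = "B / e powr p"])
      (auto simp: lessThan_Suc_atMost[symmetric] simp del: sum.lessThan_Suc)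
    then show False using weight by (simp add: lorentz_weight_def)
  qed
  have x: "x \<longlonglongrightarrow> 0"
  proof (rule LIMSEQ_I)
    fix e :: real assume "e > 0"
    then obtain K where K: "\<forall>k\<in>{k. e \<le> \<bar>x k\<bar>}. k < K"
      using fin unfolding finite_nat_set_iff_bounded by meson
    have "norm (x n - 0) < e" if "K \<le> n" for n
      using K[rule_format, of n] that by (cases "e \<le> \<bar>x n\<bar>") auto
    then show "\<exists>no. \<forall>n\<ge>no. norm (x n - 0) < e" by auto
  qed
  \<comment> \<open>Now that \<open>x\<close> is null, the greedy enumeration turns each partial sum
    of the norm series into a matching sum.\<close>
  obtain \<sigma> where \<sigma>: "inj \<sigma>" "\<And>n. drearr x n = \<bar>x (\<sigma> n)\<bar>" using drearr_attained[OF x] by metis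
  have le: "(\<Sum>i<n. w i * drearr x i powr p) \<le> B" for n
    using bound[OF matching_graph[OF inj_on_subset[OF \<sigma>(1)], of "{..<n}"]] by (simp add: wsum_graph \<sigma>(2))
  then have sm: "summable (\<lambda>n. w n * drearr x n powr p)"
    using w_nonneg by (intro bounded_imp_summable[where B = B])
      (auto simp: lessThan_Suc_atMost[symmetric] simp del: sum.lessThan_Suc)
  show "in_dwp w p x" using x sm by (simp add: in_dwp_def)
  show "norm_pow w p x \<le> B" unfolding norm_pow_def using suminf_le_const[OF sm le] .
qed

text \<open>Match the single coordinate \<open>k\<close> with rank 0, whose weight is 1.\<close>

lemma coord_le_norm_pow:
  assumes "in_dwp w p x"
  shows "\<bar>x k\<bar> powr p \<le> norm_pow w p x"
  using wsum_le_norm_pow[OF assms, of "{(k, 0)}"] by (simp add: wsum_def matching_def w_0)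

lemma coord_le_norm:
  assumes "in_dwp w p x"
  shows "\<bar>x k\<bar> \<le> norm_dwp w p x"
proof -
  have "(\<bar>x k\<bar> powr p) powr (1/p) \<le> norm_dwp w p x"
    unfolding norm_dwp_eq using coord_le_norm_pow[OF assms] p_ge_1 by (intro powr_mono2) auto
  then show ?thesis using p_ge_1 by (simp add: powr_powr)
qed

lemma wsum_scale: "wsum w p P (\<lambda>k. c * x k) = \<bar>c\<bar> powr p * wsum w p P x"
  unfolding wsum_def by (simp add: sum_distrib_left abs_mult powr_mult mult_ac)

text \<open>The upper bound holds for every factor; applying it to \<open>1/c\<close> gives the
  lower bound.\<close>

lemma norm_pow_scale:
  assumes "in_dwp w p x" and "c \<noteq> 0"
  shows "norm_pow w p (\<lambda>k. c * x k) = \<bar>c\<bar> powr p * norm_pow w p x"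
proof -
  have le: "in_dwp w p (\<lambda>k. d * y k)" "norm_pow w p (\<lambda>k. d * y k) \<le> \<bar>d\<bar> powr p * norm_pow w p y"
    if "in_dwp w p y" for d y
  proof -
    have *: "wsum w p P (\<lambda>k. d * y k) \<le> \<bar>d\<bar> powr p * norm_pow w p y" if "matching P" for P
      unfolding wsum_scale using wsum_le_norm_pow[OF \<open>in_dwp w p y\<close> that] by (simp add: mult_left_mono)
    show "in_dwp w p (\<lambda>k. d * y k)" "norm_pow w p (\<lambda>k. d * y k) \<le> \<bar>d\<bar> powr p * norm_pow w p y"
      using in_dwpI[OF *] by auto
  qed
  have "norm_pow w p (\<lambda>k. (1/c) * (c * x k)) \<le> \<bar>1/c\<bar> powr p * norm_pow w p (\<lambda>k. c * x k)"
    by (rule le(2)[OF le(1)[OF assms(1)]])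
  then have "\<bar>c\<bar> powr p * norm_pow w p x \<le> norm_pow w p (\<lambda>k. c * x k)"
    using assms(2) by (simp add: powr_divide field_simps)
  then show ?thesis using le(2)[OF assms(1), of c] by linarith
qed

text \<open>Pigeonhole: one of the \<open>n + 1\<close> positions of the largest entries of
  \<open>y\<close> lies outside the \<open>n\<close> positions of the largest entries of
  \<open>x\<close>.\<close>

lemma drearr_mono:
  assumes "x \<longlonglongrightarrow> 0" and "y \<longlonglongrightarrow> 0" and "\<And>k. \<bar>y k\<bar> \<le> \<bar>x k\<bar>"
  shows "drearr y n \<le> drearr x n"
proof -
  obtain \<sigma> where \<sigma>: "inj \<sigma>" "\<And>n k. k \<notin> \<sigma> ` {..<n} \<Longrightarrow> \<bar>x k\<bar> \<le> \<bar>x (\<sigma> n)\<bar>"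
    "\<And>n. drearr x n = \<bar>x (\<sigma> n)\<bar>" using drearr_attained[OF assms(1)] by metis
  obtain \<tau> where \<tau>: "inj \<tau>" "\<And>n k. k \<notin> \<tau> ` {..<n} \<Longrightarrow> \<bar>y k\<bar> \<le> \<bar>y (\<tau> n)\<bar>"
    "\<And>n. drearr y n = \<bar>y (\<tau> n)\<bar>" using drearr_attained[OF assms(2)] by metis
  have "\<not> \<tau> ` {..n} \<subseteq> \<sigma> ` {..<n}"
  proof
    assume "\<tau> ` {..n} \<subseteq> \<sigma> ` {..<n}"
    from card_mono[OF _ this] show False
      using inj_on_subset[OF \<sigma>(1), of "{..<n}"] inj_on_subset[OF \<tau>(1), of "{..n}"] by (simp add: card_image)
  qed
  then obtain i where i: "i \<le> n" "\<tau> i \<notin> \<sigma> ` {..<n}" by auto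
  have "\<bar>y (\<tau> n)\<bar> \<le> \<bar>y (\<tau> i)\<bar>" using i(1) \<tau>(1) by (intro \<tau>(2)) (auto simp: inj_eq)
  also have "\<dots> \<le> \<bar>x (\<tau> i)\<bar>" by (rule assms(3))
  also have "\<dots> \<le> \<bar>x (\<sigma> n)\<bar>" by (rule \<sigma>(2)[OF i(2)])
  finally show ?thesis by (simp add: \<sigma>(3) \<tau>(3))
qed

text \<open>Dropping initial coordinates makes the sup norm small, which controls the first
  \<open>L\<close> ranks; the later ranks are controlled by the tail of the norm series of
  \<open>x\<close>.\<close>

lemma small_tail:
  assumes x: "in_dwp w p x" and "0 < \<delta>"
  shows "\<forall>\<^sub>F m in sequentially. \<forall>P. matching P \<longrightarrow> fst ` P \<subseteq> {m..} \<longrightarrow> wsum w p P x \<le> \<delta>"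
proof -
  let ?f = "\<lambda>n. w n * drearr x n powr p"
  have x0: "x \<longlonglongrightarrow> 0" and sm: "summable ?f" using x by (auto simp: in_dwp_def)
  obtain L where "norm (\<Sum>n. ?f (n + L)) < \<delta>/2"
    using suminf_exist_split[OF half_gt_zero[OF \<open>0 < \<delta>\<close>] sm] by blast
  then have L: "(\<Sum>n. ?f (n + L)) < \<delta>/2" by (simp only: real_norm_def abs_less_iff)
  \<comment> \<open>Chosen so that \<open>L\<close> ranks of weight at most 1 with entries at most
    \<open>\<eta>\<close> contribute at most \<open>\<delta>/2\<close>; the \<open>+ 1\<close>
    covers \<open>L = 0\<close>.\<close>
  define \<eta> where "\<eta> = (\<delta> / (2 * (real L + 1))) powr (1/p)"
  have \<eta>: "\<eta> > 0" "\<eta> powr p = \<delta> / (2 * (real L + 1))"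
    using \<open>0 < \<delta>\<close> p_ge_1 by (auto simp: \<eta>_def powr_powr)
  have "\<forall>\<^sub>F k in sequentially. \<bar>x k\<bar> < \<eta>"
    using order_tendstoD(2)[OF tendsto_rabs_zero[OF x0] \<eta>(1)] .
  then obtain M where M: "\<And>k. k \<ge> M \<Longrightarrow> \<bar>x k\<bar> < \<eta>" by (auto simp: eventually_sequentially)
  have "wsum w p P x \<le> \<delta>" if "m \<ge> M" and P: "matching P" "fst ` P \<subseteq> {m..}" for m P
  proof -
    \<comment> \<open>\<open>P\<close> sees only coordinates from \<open>m\<close> on, so
      \<open>x\<close> may be replaced by this truncation, whose rearrangement is dominated by that
      of \<open>x\<close>.\<close>
    define y where "y k = (if k < m then 0 else x k)" for k
    have yx: "\<bar>y k\<bar> \<le> \<bar>x k\<bar>" for k by (simp add: y_def)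
    have y0: "y \<longlonglongrightarrow> 0" 
      using yx by (intro Lim_null_comparison[OF always_eventually tendsto_rabs_zero[OF x0]]) auto
    have rearr: "drearr y n \<le> drearr x n" for n by (rule drearr_mono[OF x0 y0 yx])
    obtain \<tau> where \<tau>: "\<And>n. drearr y n = \<bar>y (\<tau> n)\<bar>" using drearr_attained[OF y0] by metis
    have small: "drearr y n \<le> \<eta>" and nn: "0 \<le> drearr y n" for n
      using M[of "\<tau> n"] \<open>m \<ge> M\<close> \<eta>(1) by (auto simp: \<tau> y_def)
    let ?g = "\<lambda>n. w n * drearr y n powr p"
    have le: "?g n \<le> ?f n" for n
      using rearr nn w_nonneg p_ge_1 by (intro mult_left_mono powr_mono2) auto
    have smg: "summable ?g" using le w_nonneg by (intro summable_comparison_test[OF _ sm]) auto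
    have yd: "in_dwp w p y" using y0 smg by (simp add: in_dwp_def)
    have "wsum w p P x = wsum w p P y"
      unfolding wsum_def using P(2) by (intro sum.cong) (auto simp: y_def)
    also have "\<dots> \<le> suminf ?g" using wsum_le_norm_pow[OF yd P(1)] by (simp add: norm_pow_def)
    also have "\<dots> = (\<Sum>n. ?g (n + L)) + (\<Sum>n<L. ?g n)" by (rule suminf_split_initial_segment[OF smg])
    also have "(\<Sum>n. ?g (n + L)) \<le> (\<Sum>n. ?f (n + L))"
      using le smg sm by (intro suminf_le) (auto simp: summable_iff_shift[of ?f] summable_iff_shift[of ?g])
    also have "(\<Sum>n<L. ?g n) \<le> (\<Sum>n<L. \<eta> powr p)"
    proof (intro sum_mono)
      fix n
      have "?g n \<le> 1 * \<eta> powr p"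
        using small[of n] nn[of n] w_nonneg[of n] w_le_1[of n] p_ge_1 by (intro mult_mono powr_mono2) auto
      then show "?g n \<le> \<eta> powr p" by simp
    qed
    also have "(\<Sum>n<L. \<eta> powr p) \<le> \<delta>/2"
      using \<open>0 < \<delta>\<close> by (simp add: \<eta>(2) field_simps)
    finally show ?thesis using L by simp
  qed
  then show ?thesis unfolding eventually_sequentially by blast
qed

end

subsection \<open>Linear algebra and power inequalities\<close>

text \<open>\<open>V\<close> is an explicit set so that the lemma serves both the subspace
  \<open>Y\<close> and the whole Lorentz space.\<close>

lemma linear_combination:
  fixes T :: "(nat \<Rightarrow> real) \<Rightarrow> (nat \<Rightarrow> real)"
  assumes zero: "(\<lambda>k. 0) \<in> V"
    and add: "\<And>x y. x \<in> V \<Longrightarrow> y \<in> V \<Longrightarrow> (\<lambda>k. x k + y k) \<in> V"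
    and scale: "\<And>c x. x \<in> V \<Longrightarrow> (\<lambda>k. c * x k) \<in> V"
    and T_add: "\<And>x y. x \<in> V \<Longrightarrow> y \<in> V \<Longrightarrow> T (\<lambda>k. x k + y k) = (\<lambda>k. T x k + T y k)"
    and T_scale: "\<And>c x. x \<in> V \<Longrightarrow> T (\<lambda>k. c * x k) = (\<lambda>k. c * T x k)"
    and "finite I" and "\<And>i. i \<in> I \<Longrightarrow> f i \<in> V"
  shows "(\<lambda>k. \<Sum>i\<in>I. c i * f i k) \<in> V"
    and "T (\<lambda>k. \<Sum>i\<in>I. c i * f i k) = (\<lambda>k. \<Sum>i\<in>I. c i * T (f i) k)"
proof -
  have "(\<lambda>k. \<Sum>i\<in>I. c i * f i k) \<in> V \<and>
      T (\<lambda>k. \<Sum>i\<in>I. c i * f i k) = (\<lambda>k. \<Sum>i\<in>I. c i * T (f i) k)"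
    using assms(6,7)
  proof (induction I rule: finite_induct)
    case empty
    have "T (\<lambda>k. 0) = (\<lambda>k. 0)" using T_scale[OF zero, of 0] by simp
    then show ?case using zero by simp
  next
    case (insert i I)
    then have ih: "(\<lambda>k. \<Sum>i\<in>I. c i * f i k) \<in> V"
      "T (\<lambda>k. \<Sum>i\<in>I. c i * f i k) = (\<lambda>k. \<Sum>i\<in>I. c i * T (f i) k)" and fi: "f i \<in> V" by auto
    have "(\<lambda>k. c i * f i k + (\<Sum>i\<in>I. c i * f i k)) \<in> V"
      by (rule add[OF scale[OF fi] ih(1)])
    moreover have "T (\<lambda>k. c i * f i k + (\<Sum>i\<in>I. c i * f i k)) = (\<lambda>k. c i * T (f i) k + (\<Sum>i\<in>I. c i * T (f i) k))"
      by (simp only: T_add[OF scale[OF fi] ih(1)] T_scale[OF fi] ih(2))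
    ultimately show ?case using insert.hyps by simp
  qed
  then show "(\<lambda>k. \<Sum>i\<in>I. c i * f i k) \<in> V"
    and "T (\<lambda>k. \<Sum>i\<in>I. c i * f i k) = (\<lambda>k. \<Sum>i\<in>I. c i * T (f i) k)" by auto
qed

text \<open>Gaussian elimination, one equation and one unknown at a time.\<close>

lemma underdetermined_system:
  fixes A :: "nat \<Rightarrow> 'a \<Rightarrow> real"
  assumes "finite I" and "r < card I"
  shows "\<exists>c. (\<exists>i\<in>I. c i \<noteq> 0) \<and> (\<forall>l<r. (\<Sum>i\<in>I. c i * A l i) = 0)"
  using assms
proof (induction r arbitrary: I A)
  case 0
  then have "I \<noteq> {}" by auto
  then show ?case by (intro exI[of _ "\<lambda>_. 1"]) auto
next
  case (Suc r)
  show ?case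
  proof (cases "\<forall>i\<in>I. A r i = 0")
    case True
    obtain c where c: "\<exists>i\<in>I. c i \<noteq> 0" "\<And>l. l < r \<Longrightarrow> (\<Sum>i\<in>I. c i * A l i) = 0"
      using Suc.IH[of I A] Suc.prems by auto
    have "(\<Sum>i\<in>I. c i * A r i) = 0" using True by simp
    then show ?thesis using c by (intro exI[of _ c]) (auto simp: less_Suc_eq)
  next
    case False
    then obtain i0 where i0: "i0 \<in> I" "A r i0 \<noteq> 0" by auto
    \<comment> \<open>Subtracting a multiple of equation \<open>r\<close> eliminates the unknown
      \<open>i0\<close> from the other equations; the value \<open>s\<close> below then solves
      equation \<open>r\<close>.\<close>
    define A' where "A' l i = A l i - A l i0 * A r i / A r i0" for l i
    have "r < card (I - {i0})" using Suc.prems i0 by simp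
    from Suc.IH[OF _ this, of A'] Suc.prems(1) obtain c where
      c: "\<exists>i\<in>I-{i0}. c i \<noteq> 0" "\<And>l. l < r \<Longrightarrow> (\<Sum>i\<in>I-{i0}. c i * A' l i) = 0" by auto
    define s where "s = - (\<Sum>i\<in>I-{i0}. c i * A r i) / A r i0"
    define d where "d = c(i0 := s)"
    have sum_d: "(\<Sum>i\<in>I. d i * A l i) = s * A l i0 + (\<Sum>i\<in>I-{i0}. c i * A l i)" for l
      using Suc.prems(1) i0(1) by (simp add: sum.remove d_def)
    have r0: "(\<Sum>i\<in>I. d i * A r i) = 0" using i0(2) by (simp add: sum_d s_def)
    have "(\<Sum>i\<in>I. d i * A l i) = 0" if "l < r" for l
    proof -
      have "0 = (\<Sum>i\<in>I-{i0}. c i * A l i - (A l i0 / A r i0) * (c i * A r i))"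
        using c(2)[OF that] by (simp add: A'_def algebra_simps)
      also have "\<dots> = (\<Sum>i\<in>I-{i0}. c i * A l i) - (A l i0 / A r i0) * (\<Sum>i\<in>I-{i0}. c i * A r i)"
        by (simp only: sum_subtractf sum_distrib_left)
      also have "\<dots> = (\<Sum>i\<in>I. d i * A l i)" by (simp add: sum_d s_def)
      finally show ?thesis by simp
    qed
    moreover have "\<exists>i\<in>I. d i \<noteq> 0" using c(1) by (auto simp: d_def)
    ultimately show ?thesis using r0 by (intro exI[of _ d]) (auto simp: less_Suc_eq)
  qed
qed

section \<open>Inequalities for p-th powers of sums\<close>

lemma abs_add_powr_le:
  fixes a b p :: real
  assumes "1 \<le> p"
  shows "\<bar>a + b\<bar> powr p \<le> 2 powr p * (\<bar>a\<bar> powr p + \<bar>b\<bar> powr p)"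
proof -
  have "\<bar>a + b\<bar> powr p \<le> (2 * max \<bar>a\<bar> \<bar>b\<bar>) powr p" using assms by (intro powr_mono2) auto
  also have "\<dots> = 2 powr p * max \<bar>a\<bar> \<bar>b\<bar> powr p" by (simp add: powr_mult)
  also have "\<dots> \<le> 2 powr p * (\<bar>a\<bar> powr p + \<bar>b\<bar> powr p)"
    by (intro mult_left_mono) (auto simp: max_def)
  finally show ?thesis .
qed

text \<open>Splitting off the first term repeatedly costs the \<open>i\<close>-th term
  \<open>i + 1\<close> factors \<open>2 powr p\<close>. These geometric losses dictate how fast the
  tails of the blocks must decay.\<close>

lemma abs_sum_powr_le:
  fixes p :: real
  assumes "1 \<le> p"
  shows "\<bar>\<Sum>i<n. t i\<bar> powr p \<le> (\<Sum>i<n. (2 powr p) ^ Suc i * \<bar>t i\<bar> powr p)"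
proof (induction n arbitrary: t)
  case 0 then show ?case by simp
next
  case (Suc n)
  have "\<bar>\<Sum>i<Suc n. t i\<bar> powr p = \<bar>t 0 + (\<Sum>i<n. t (Suc i))\<bar> powr p"
    by (simp only: sum.lessThan_Suc_shift)
  also have "\<dots> \<le> 2 powr p * (\<bar>t 0\<bar> powr p + \<bar>\<Sum>i<n. t (Suc i)\<bar> powr p)" by (rule abs_add_powr_le[OF assms])
  also have "\<dots> \<le> 2 powr p * (\<bar>t 0\<bar> powr p + (\<Sum>i<n. (2 powr p) ^ Suc i * \<bar>t (Suc i)\<bar> powr p))"
    by (intro mult_left_mono add_left_mono Suc.IH) auto
  also have "\<dots> = (\<Sum>i<Suc n. (2 powr p) ^ Suc i * \<bar>t i\<bar> powr p)"
    by (simp add: sum.lessThan_Suc_shift sum_distrib_left distrib_left mult_ac del: sum.lessThan_Suc)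
  finally show ?case .
qed

lemma abs_sum_powr_single:
  fixes p :: real and t :: "'a \<Rightarrow> real"
  assumes "finite I" and "\<And>i j. i \<in> I \<Longrightarrow> j \<in> I \<Longrightarrow> t i \<noteq> 0 \<Longrightarrow> t j \<noteq> 0 \<Longrightarrow> i = j"
  shows "\<bar>\<Sum>i\<in>I. t i\<bar> powr p = (\<Sum>i\<in>I. \<bar>t i\<bar> powr p)"
proof (cases "\<exists>i\<in>I. t i \<noteq> 0")
  case True
  then obtain i where i: "i \<in> I" "t i \<noteq> 0" by auto
  have z: "t j = 0" if "j \<in> I - {i}" for j using that i assms(2)[of i j] by auto
  have "(\<Sum>i\<in>I. t i) = t i" using assms(1) i(1) z by (simp add: sum.remove)
  moreover have "(\<Sum>i\<in>I. \<bar>t i\<bar> powr p) = \<bar>t i\<bar> powr p" using assms(1) i(1) z by (simp add: sum.remove)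
  ultimately show ?thesis by simp
qed simp

text \<open>Jensen's inequality for the convex function \<open>t powr p\<close>.\<close>

lemma weighted_mean_powr:
  fixes p :: real
  assumes "1 \<le> p" and "finite S" and nn: "\<And>i. i \<in> S \<Longrightarrow> 0 \<le> b i" and one: "sum b S = 1"
  shows "\<bar>\<Sum>i\<in>S. b i * t i\<bar> powr p \<le> (\<Sum>i\<in>S. b i * \<bar>t i\<bar> powr p)"
proof -
  \<comment> \<open>On \<open>R\<close> all weights and all arguments \<open>\<bar>t i\<bar>\<close>
    are positive, and Jensen applies after dividing by the total weight \<open>s\<close>. Undoing
    this costs nothing, since \<open>s powr p \<le> s\<close> for
    \<open>0 < s \<le> 1\<close>.\<close>
  define R where "R = {i \<in> S. b i \<noteq> 0 \<and> t i \<noteq> 0}"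
  define s where "s = sum b R"
  have R: "finite R" "R \<subseteq> S" using assms(2) by (auto simp: R_def)
  have s1: "s \<le> 1" unfolding s_def one[symmetric] using assms(2) R nn by (intro sum_mono2) auto
  have eq: "(\<Sum>i\<in>S. b i * \<bar>t i\<bar> powr p) = (\<Sum>i\<in>R. b i * \<bar>t i\<bar> powr p)"
    "(\<Sum>i\<in>S. b i * \<bar>t i\<bar>) = (\<Sum>i\<in>R. b i * \<bar>t i\<bar>)"
    using assms(2) by (auto simp: R_def intro!: sum.mono_neutral_right)
  have "\<bar>\<Sum>i\<in>S. b i * t i\<bar> \<le> (\<Sum>i\<in>S. b i * \<bar>t i\<bar>)"
    using nn by (intro order_trans[OF sum_abs] sum_mono) (auto simp: abs_mult)
  then have le: "\<bar>\<Sum>i\<in>S. b i * t i\<bar> powr p \<le> (\<Sum>i\<in>R. b i * \<bar>t i\<bar>) powr p"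
    unfolding eq using assms(1) by (intro powr_mono2) auto
  show ?thesis
  proof (cases "R = {}")
    case True then show ?thesis using le eq by simp
  next
    case False
    have pos: "b i > 0" if "i \<in> R" for i using that nn[of i] by (auto simp: R_def)
    have s0: "s > 0" unfolding s_def using R(1) False pos by (intro sum_pos) auto
    have "(\<Sum>i\<in>R. (b i / s) *\<^sub>R \<bar>t i\<bar>) powr p \<le> (\<Sum>i\<in>R. (b i / s) * \<bar>t i\<bar> powr p)"
      using R(1) False pos s0
      by (intro convex_on_sum[OF _ _ powr_convex[OF assms(1)]])
        (auto simp: s_def R_def sum_divide_distrib[symmetric] less_imp_le)
    then have *: "(\<Sum>i\<in>R. b i / s * \<bar>t i\<bar>) powr p \<le> (\<Sum>i\<in>R. b i * \<bar>t i\<bar> powr p) / s"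
      by (simp add: sum_divide_distrib)
    have "(\<Sum>i\<in>R. b i * \<bar>t i\<bar>) = s * (\<Sum>i\<in>R. b i / s * \<bar>t i\<bar>)"
      using s0 by (simp add: sum_distrib_left)
    then have "(\<Sum>i\<in>R. b i * \<bar>t i\<bar>) powr p = s powr p * (\<Sum>i\<in>R. b i / s * \<bar>t i\<bar>) powr p"
      using s0 pos by (simp add: powr_mult sum_nonneg less_imp_le)
    also have "\<dots> \<le> s * (\<Sum>i\<in>R. b i / s * \<bar>t i\<bar>) powr p"
      using powr_mono'[of 1 p s] s0 s1 assms(1) by (intro mult_right_mono) auto
    also have "\<dots> \<le> s * ((\<Sum>i\<in>R. b i * \<bar>t i\<bar> powr p) / s)"
      using * s0 by (intro mult_left_mono) auto
    finally show ?thesis using le eq s0 by simp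
  qed
qed

section \<open>The Lorentz space as a vector space\<close>

context lorentz
begin

lemma in_dwp_zero: "in_dwp w p (\<lambda>k. 0)"
  by (rule in_dwpI(1)[of _ 0]) (simp add: wsum_def)

lemma in_dwp_scale:
  assumes "in_dwp w p x"
  shows "in_dwp w p (\<lambda>k. c * x k)"
  using wsum_le_norm_pow[OF assms]
  by (intro in_dwpI(1)[of _ "\<bar>c\<bar> powr p * norm_pow w p x"]) (simp add: wsum_scale mult_left_mono)

lemma in_dwp_add:
  assumes "in_dwp w p x" and "in_dwp w p y"
  shows "in_dwp w p (\<lambda>k. x k + y k)"
proof (rule in_dwpI(1))
  fix P assume P: "matching P"
  have "wsum w p P (\<lambda>k. x k + y k) \<le> (\<Sum>q\<in>P. w (snd q) * (2 powr p * (\<bar>x (fst q)\<bar> powr p + \<bar>y (fst q)\<bar> powr p)))"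
    unfolding wsum_def using w_nonneg p_ge_1 by (intro sum_mono mult_left_mono abs_add_powr_le) auto
  also have "\<dots> = 2 powr p * (wsum w p P x + wsum w p P y)"
    by (simp add: wsum_def sum.distrib[symmetric] sum_distrib_left algebra_simps)
  also have "\<dots> \<le> 2 powr p * (norm_pow w p x + norm_pow w p y)"
    using wsum_le_norm_pow[OF assms(1) P] wsum_le_norm_pow[OF assms(2) P]
    by (intro mult_left_mono add_mono) auto
  finally show "wsum w p P (\<lambda>k. x k + y k) \<le> 2 powr p * (norm_pow w p x + norm_pow w p y)" .
qed

end

subsection \<open>Flat images of vectors in the subspace\<close>

locale fixing_operator = lorentz +
  fixes T :: "(nat \<Rightarrow> real) \<Rightarrow> (nat \<Rightarrow> real)" and Y :: "(nat \<Rightarrow> real) set" and c :: real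
  assumes T: "T \<in> L_dwp w p" and Y: "closed_subspace_dwp w p Y" and inf_dim: "infinite_dim Y"
    and c_pos: "c > 0" and below: "\<And>y. y \<in> Y \<Longrightarrow> c * norm_dwp w p y \<le> norm_dwp w p (T y)"
begin

lemma
  shows Y_dwp: "y \<in> Y \<Longrightarrow> in_dwp w p y" and Y_zero: "(\<lambda>k. 0) \<in> Y"
    and Y_add: "x \<in> Y \<Longrightarrow> y \<in> Y \<Longrightarrow> (\<lambda>k. x k + y k) \<in> Y"
    and Y_scale: "y \<in> Y \<Longrightarrow> (\<lambda>k. a * y k) \<in> Y"
  using Y unfolding closed_subspace_dwp_def by auto

lemma
  shows T_dwp: "in_dwp w p x \<Longrightarrow> in_dwp w p (T x)"
    and T_add: "in_dwp w p x \<Longrightarrow> in_dwp w p y \<Longrightarrow> T (\<lambda>k. x k + y k) = (\<lambda>k. T x k + T y k)"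
    and T_scale: "in_dwp w p x \<Longrightarrow> T (\<lambda>k. a * x k) = (\<lambda>k. a * T x k)"
  using T unfolding L_dwp_def bounded_op_def by auto

definition Y_from :: "nat \<Rightarrow> (nat \<Rightarrow> real) set" where
  "Y_from m = {y \<in> Y. \<forall>k<m. y k = 0 \<and> T y k = 0}"

lemma Y_from_scale:
  assumes "y \<in> Y_from m"
  shows "(\<lambda>k. a * y k) \<in> Y_from m" and "T (\<lambda>k. a * y k) = (\<lambda>k. a * T y k)"
  using assms Y_scale T_scale Y_dwp by (auto simp: Y_from_def)

text \<open>Membership in \<open>Y_from m\<close> imposes \<open>2 m\<close> linear equations.\<close>

lemma ex_nonzero_image: "\<exists>y\<in>Y_from m. \<exists>k. T y k \<noteq> 0"
proof -
  \<comment> \<open>One more unknown than there are equations.\<close>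
  let ?n = "2 * m + 1"
  from inf_dim[unfolded infinite_dim_def, THEN spec, of ?n]
  obtain f where f: "\<forall>i<?n. f i \<in> Y"
    and indep: "\<forall>a. (\<lambda>k. \<Sum>i<?n. a i * f i k) = (\<lambda>k. 0) \<longrightarrow> (\<forall>i<?n. a i = 0)"
    by (elim exE conjE)
  \<comment> \<open>The first \<open>m\<close> rows are coordinates of \<open>f i\<close>, the next
    \<open>m\<close> rows coordinates of its image.\<close>
  define A where "A l i = (if l < m then f i l else T (f i) (l - m))" for l i
  obtain a where a: "\<exists>i<?n. a i \<noteq> 0" "\<And>l. l < 2 * m \<Longrightarrow> (\<Sum>i<?n. a i * A l i) = 0"
    using underdetermined_system[of "{..<?n}" "2 * m" A] by auto
  define y where "y = (\<lambda>k. \<Sum>i<?n. a i * f i k)"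
  have fY: "f i \<in> Y" if "i \<in> {..<?n}" for i using f that by simp
  note comb = linear_combination[where V = Y and T = T and I = "{..<?n}" and f = f and c = a,
    OF Y_zero Y_add Y_scale T_add[OF Y_dwp Y_dwp] T_scale[OF Y_dwp] finite_lessThan fY]
  have yY: "y \<in> Y" and Ty: "T y = (\<lambda>k. \<Sum>i<?n. a i * T (f i) k)"
    unfolding y_def by (rule comb; assumption)+
  have "y k = 0 \<and> T y k = 0" if "k < m" for k
    unfolding Ty using a(2)[of k] a(2)[of "k + m"] that by (simp add: y_def A_def del: sum.lessThan_Suc)
  then have mem: "y \<in> Y_from m" using yY by (simp add: Y_from_def)
  have "y \<noteq> (\<lambda>k. 0)"
  proof
    assume "y = (\<lambda>k. 0)"
    with indep[THEN spec, of a] have "\<forall>i<?n. a i = 0" unfolding y_def by (rule mp)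
    then show False using a(1) by blast
  qed
  then obtain k where k: "y k \<noteq> 0" by auto
  then have "0 < \<bar>y k\<bar>" by simp
  also have "\<dots> \<le> norm_dwp w p y" by (rule coord_le_norm[OF Y_dwp[OF yY]])
  finally have "0 < c * norm_dwp w p y" using c_pos by simp
  then have pos: "0 < norm_dwp w p (T y)" using below[OF yY] by linarith
  have "\<exists>k. T y k \<noteq> 0"
  proof (rule ccontr)
    assume "\<not> ?thesis"
    then have "T y = (\<lambda>k. 0)" by auto
    then have "norm_pow w p (T y) \<le> 0" by (intro in_dwpI(2)) (simp add: wsum_def)
    then show False using pos norm_pow_nonneg[OF T_dwp[OF Y_dwp[OF yY]]] by (simp add: norm_dwp_eq)
  qed
  then show ?thesis using mem by blast
qed

text \<open>Each induction step adds a vector whose image has peak value 1 and lives where the image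
  of \<open>s\<close> is already below 1/2. This creates one new large coordinate, keeps the old
  ones, and respects the bound \<open>3/2 = 1/2 + 1\<close>.\<close>

lemma ex_flat_image:
  "\<exists>s\<in>Y_from m. (\<forall>k. \<bar>T s k\<bar> \<le> 3/2) \<and> n \<le> card {k. 1/2 \<le> \<bar>T s k\<bar>}"
proof (induction n)
  case 0
  have "T (\<lambda>k. 0) = (\<lambda>k. 0)" using T_scale[OF in_dwp_zero, of 0] by simp
  then show ?case using Y_zero by (intro bexI[of _ "\<lambda>k. 0"]) (auto simp: Y_from_def)
next
  case (Suc n)
  then obtain s where s: "s \<in> Y_from m" "\<And>k. \<bar>T s k\<bar> \<le> 3/2" "n \<le> card {k. 1/2 \<le> \<bar>T s k\<bar>}" by auto
  have sY: "s \<in> Y" using s(1) by (simp add: Y_from_def)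
  have null: "T x \<longlonglongrightarrow> 0" if "x \<in> Y" for x using T_dwp[OF Y_dwp[OF that]] by (simp add: in_dwp_def)
  have "\<forall>\<^sub>F k in sequentially. \<bar>T s k\<bar> < 1/2"
    using order_tendstoD(2)[OF tendsto_rabs_zero[OF null[OF sY]], of "1/2"] by simp
  then obtain M0 where M0: "\<And>k. k \<ge> M0 \<Longrightarrow> \<bar>T s k\<bar> < 1/2" by (auto simp: eventually_sequentially)
  \<comment> \<open>Before \<open>M\<close> the vectors of \<open>Y_from M\<close> and their images
    vanish; from \<open>M\<close> on \<open>T s\<close> is below 1/2.\<close>
  define M where "M = max m M0"
  obtain y where y: "y \<in> Y_from M" "\<exists>k. T y k \<noteq> 0" using ex_nonzero_image by blast
  have yY: "y \<in> Y" using y(1) by (simp add: Y_from_def)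
  obtain k0 where k0: "\<And>k. \<bar>T y k\<bar> \<le> \<bar>T y k0\<bar>"
    using ex_max_outside_finite[OF null[OF yY], of "{}"] by auto
  have nz: "T y k0 \<noteq> 0" using y(2) k0 by fastforce
  define v where "v = (\<lambda>k. (1 / T y k0) * y k)"
  have v: "v \<in> Y_from M" and Tv: "T v = (\<lambda>k. (1 / T y k0) * T y k)"
    unfolding v_def by (rule Y_from_scale[OF y(1)])+
  have vY: "v \<in> Y" using v by (simp add: Y_from_def)
  have v1: "\<bar>T v k\<bar> \<le> 1" "T v k0 = 1" for k using k0[of k] nz by (auto simp: Tv abs_mult field_simps)
  have v0: "T v k = 0" "v k = 0" if "k < M" for k using v that by (auto simp: Y_from_def)
  have k0M: "M \<le> k0" using v0(1)[of k0] v1(2) by (cases "k0 < M") auto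
  define u where "u = (\<lambda>k. s k + v k)"
  have Tu: "T u k = T s k + T v k" for k
    unfolding u_def using T_add[OF Y_dwp[OF sY] Y_dwp[OF vY]] by simp
  have uY: "u \<in> Y" unfolding u_def by (rule Y_add[OF sY vY])
  have "u k = 0 \<and> T u k = 0" if "k < m" for k
    using that s(1) v0[of k] unfolding Tu by (simp add: Y_from_def M_def u_def)
  then have "u \<in> Y_from m" using uY by (simp add: Y_from_def)
  moreover have "\<bar>T u k\<bar> \<le> 3/2" for k
  proof (cases "k < M")
    case True then show ?thesis using s(2)[of k] v0(1)[of k] by (simp add: Tu)
  next
    case False
    then have "\<bar>T s k\<bar> < 1/2" using M0 by (simp add: M_def)
    then show ?thesis using v1(1)[of k] abs_triangle_ineq[of "T s k" "T v k"] by (simp add: Tu)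
  qed
  moreover have "Suc n \<le> card {k. 1/2 \<le> \<bar>T u k\<bar>}"
  proof -
    have "\<forall>\<^sub>F k in sequentially. \<bar>T u k\<bar> < 1/2"
      using order_tendstoD(2)[OF tendsto_rabs_zero[OF null[OF uY]], of "1/2"] by simp
    then obtain M1 where M1: "\<And>k. k \<ge> M1 \<Longrightarrow> \<bar>T u k\<bar> < 1/2" by (auto simp: eventually_sequentially)
    have "{k. 1/2 \<le> \<bar>T u k\<bar>} \<subseteq> {..<M1}" using M1 by (force simp: not_le[symmetric])
    then have fin: "finite {k. 1/2 \<le> \<bar>T u k\<bar>}" by (rule finite_subset) simp
    have lt: "k < M" if "1/2 \<le> \<bar>T s k\<bar>" for k using M0[of k] that by (cases "M0 \<le> k") (auto simp: M_def)
    then have "{k. 1/2 \<le> \<bar>T s k\<bar>} \<subseteq> {..<M}" by auto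
    then have fins: "finite {k. 1/2 \<le> \<bar>T s k\<bar>}" by (rule finite_subset) simp
    have "k0 \<notin> {k. 1/2 \<le> \<bar>T s k\<bar>}" using lt[of k0] k0M by auto
    then have "card (insert k0 {k. 1/2 \<le> \<bar>T s k\<bar>}) = Suc (card {k. 1/2 \<le> \<bar>T s k\<bar>})"
      using fins by (rule card_insert_disjoint[rotated])
    \<comment> \<open>At \<open>k0\<close> the new image is at least \<open>1 - 1/2\<close>; before
      \<open>M\<close> it coincides with \<open>T s\<close>.\<close>
    moreover have sub: "insert k0 {k. 1/2 \<le> \<bar>T s k\<bar>} \<subseteq> {k. 1/2 \<le> \<bar>T u k\<bar>}"
      using M0[of k0] k0M v1(2) lt v0 by (auto simp: Tu M_def)
    ultimately show ?thesis using card_mono[OF fin sub] s(3) by linarith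
  qed
  ultimately show ?case by blast
qed

text \<open>Many coordinates of size at least 1/2 force a large norm because the weight is not
  summable, while the entries stay below 3/2; normalizing then makes all entries small.\<close>

lemma ex_normalized_flat_image:
  assumes "0 < \<epsilon>"
  shows "\<exists>y\<in>Y_from m. norm_pow w p (T y) = 1 \<and> (\<forall>k. \<bar>T y k\<bar> \<le> \<epsilon>)"
proof -
  have "\<not> (\<forall>n. (\<Sum>i<n. w i) \<le> (3/\<epsilon>) powr p)"
  proof
    assume "\<forall>n. (\<Sum>i<n. w i) \<le> (3/\<epsilon>) powr p"
    then have "summable w" using w_nonneg by (intro bounded_imp_summable[where B = "(3/\<epsilon>) powr p"])
      (auto simp: lessThan_Suc_atMost[symmetric] simp del: sum.lessThan_Suc)
    then show False using weight by (simp add: lorentz_weight_def)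
  qed
  \<comment> \<open>The norm is at least half the \<open>p\<close>-th root of the weight sum, hence
    exceeds \<open>(3/2)/\<epsilon>\<close>, as the sup bound 3/2 requires.\<close>
  then obtain n where n: "(3/\<epsilon>) powr p < (\<Sum>i<n. w i)" by (auto simp: not_le)
  obtain s where s: "s \<in> Y_from m" "\<And>k. \<bar>T s k\<bar> \<le> 3/2" "n \<le> card {k. 1/2 \<le> \<bar>T s k\<bar>}"
    using ex_flat_image[of m n] by auto
  have d: "in_dwp w p (T s)" using s(1) Y_dwp T_dwp by (simp add: Y_from_def)
  obtain G where G: "G \<subseteq> {k. 1/2 \<le> \<bar>T s k\<bar>}" "card G = n" "finite G"
    using obtain_subset_with_card_n[OF s(3)] by metis
  obtain h where h: "bij_betw h {..<n} G"
    using ex_bij_betw_nat_finite[OF G(3)] G(2) by (auto simp: atLeast0LessThan)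
  define L where "L = norm_pow w p (T s)"
  have "(1/2) powr p * (\<Sum>i<n. w i) \<le> (\<Sum>i<n. w i * \<bar>T s (h i)\<bar> powr p)"
    unfolding sum_distrib_left
  proof (intro sum_mono)
    fix i assume "i \<in> {..<n}"
    then have "h i \<in> G" using h by (auto simp: bij_betw_def)
    then have "(1/2) powr p \<le> \<bar>T s (h i)\<bar> powr p" using G(1) p_ge_1 by (intro powr_mono2) auto
    then show "(1/2) powr p * w i \<le> w i * \<bar>T s (h i)\<bar> powr p"
      using w_nonneg[of i] by (simp add: mult.commute mult_left_mono)
  qed
  also have "\<dots> \<le> L"
    using wsum_le_norm_pow[OF d matching_graph[OF bij_betw_imp_inj_on[OF h]]] by (simp add: L_def wsum_graph)
  finally have le: "(1/2) powr p * (\<Sum>i<n. w i) \<le> L" .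
  have "(3/2/\<epsilon>) powr p = (1/2) powr p * (3/\<epsilon>) powr p"
    using assms by (simp add: powr_mult[symmetric])
  also have "\<dots> < (1/2) powr p * (\<Sum>i<n. w i)" using n by simp
  finally have L: "(3/2/\<epsilon>) powr p < L" using le by simp
  have L0: "0 < L" using L by (rule le_less_trans[rotated]) simp
  define a where "a = L powr (-1/p)"
  have "a powr p = L powr (-1)" using p_ge_1 by (simp add: a_def powr_powr)
  then have a: "0 < a" "a powr p = 1 / L" using L0 by (auto simp: a_def powr_minus_divide)
  have "((3/2/\<epsilon>) powr p) powr (1/p) \<le> L powr (1/p)" using L p_ge_1 by (intro powr_mono2) auto
  then have "3/2/\<epsilon> \<le> L powr (1/p)" using p_ge_1 assms by (simp add: powr_powr)
  then have "a * (3/2) \<le> a * (\<epsilon> * L powr (1/p))"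
    using assms a(1) by (intro mult_left_mono) (auto simp: field_simps)
  also have "\<dots> = \<epsilon>" using L0 by (simp add: a_def powr_minus_divide)
  finally have aeps: "a * (3/2) \<le> \<epsilon>" .
  have "norm_pow w p (T (\<lambda>k. a * s k)) = 1"
    using norm_pow_scale[OF d, of a] a L0 by (simp add: Y_from_scale(2)[OF s(1)] L_def)
  moreover have "\<bar>T (\<lambda>k. a * s k) k\<bar> \<le> \<epsilon>" for k
  proof -
    have "a * \<bar>T s k\<bar> \<le> a * (3/2)" using s(2)[of k] a(1) by (intro mult_left_mono) auto
    moreover have "\<bar>a * T s k\<bar> = a * \<bar>T s k\<bar>" using a(1) by (simp add: abs_mult)
    ultimately show ?thesis using aeps unfolding Y_from_scale(2)[OF s(1)] by linarith
  qed
  ultimately show ?thesis using Y_from_scale(1)[OF s(1), of a] by blast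
qed

text \<open>One step of the gliding hump. Flatness keeps the share of the ranks below
  \<open>m\<close> small, so half of the norm power sits on finitely many ranks from
  \<open>m\<close> on.\<close>

lemma ex_block:
  assumes "0 < \<delta>"
  shows "\<exists>y\<in>Y_from m. \<exists>m'>m. \<exists>P. norm_pow w p (T y) = 1 \<and> matching P \<and>
    fst ` P \<subseteq> {m..<m'} \<and> snd ` P \<subseteq> {m..<m'} \<and> 1/2 \<le> wsum w p P (T y) \<and> (\<forall>q\<in>P. T y (fst q) \<noteq> 0) \<and>
    (\<forall>Q. matching Q \<longrightarrow> fst ` Q \<subseteq> {m'..} \<longrightarrow> wsum w p Q y \<le> \<delta> \<and> wsum w p Q (T y) \<le> \<delta>)"
proof -
  \<comment> \<open>The first \<open>m\<close> ranks, of weight at most 1 each, then carry at most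
    1/4.\<close>
  define \<epsilon> where "\<epsilon> = (1 / (4 * (real m + 1))) powr (1/p)"
  have \<epsilon>: "0 < \<epsilon>" "\<epsilon> powr p = 1 / (4 * (real m + 1))" using p_ge_1 by (auto simp: \<epsilon>_def powr_powr)
  obtain y where y: "y \<in> Y_from m" "norm_pow w p (T y) = 1" "\<And>k. \<bar>T y k\<bar> \<le> \<epsilon>"
    using ex_normalized_flat_image[OF \<epsilon>(1)] by blast
  have yd: "in_dwp w p y" using y(1) Y_dwp by (simp add: Y_from_def)
  define z where "z = T y"
  have zd: "in_dwp w p z" unfolding z_def by (rule T_dwp[OF yd])
  have z0: "z \<longlonglongrightarrow> 0" using zd by (simp add: in_dwp_def)
  obtain \<sigma> where \<sigma>: "inj \<sigma>" "\<And>n. drearr z n = \<bar>z (\<sigma> n)\<bar>" using drearr_attained[OF z0] by metis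
  let ?g = "\<lambda>n. w n * \<bar>z (\<sigma> n)\<bar> powr p"
  have "?g sums 1" using zd y(2) \<sigma>(2) by (auto simp: in_dwp_def norm_pow_def z_def sums_iff)
  then have "(\<lambda>n. sum ?g {..<n}) \<longlonglongrightarrow> 1" by (simp add: sums_def)
  then have "\<forall>\<^sub>F n in sequentially. 3/4 < sum ?g {..<n}" by (rule order_tendstoD(1)) simp
  then obtain L0 where L0: "\<And>n. n \<ge> L0 \<Longrightarrow> 3/4 < sum ?g {..<n}" by (auto simp: eventually_sequentially)
  define L where "L = max L0 m"
  have "sum ?g {..<m} \<le> (\<Sum>i<m. \<epsilon> powr p)"
  proof (intro sum_mono)
    fix n
    have "?g n \<le> 1 * \<epsilon> powr p"
      using y(3) w_nonneg[of n] w_le_1[of n] p_ge_1 by (intro mult_mono powr_mono2) (auto simp: z_def)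
    then show "?g n \<le> \<epsilon> powr p" by simp
  qed
  also have "\<dots> \<le> 1/4" by (simp add: \<epsilon>(2) field_simps)
  finally have "sum ?g {..<m} \<le> 1/4" .
  moreover have "sum ?g {..<L} = sum ?g {..<m} + sum ?g {m..<L}"
    using sum.atLeastLessThan_concat[of 0 m L ?g] by (simp add: atLeast0LessThan L_def)
  ultimately have half: "1/2 \<le> sum ?g {m..<L}" using L0[of L] by (simp add: L_def)
  \<comment> \<open>Dropping zero entries permits later division by \<open>z\<close>, and forces the
    remaining coordinates to be at least \<open>m\<close>, since \<open>z\<close> vanishes before
    \<open>m\<close>.\<close>
  define I where "I = {i \<in> {m..<L}. z (\<sigma> i) \<noteq> 0}"
  define P where "P = (\<lambda>i. (\<sigma> i, i)) ` I"
  have PM: "matching P" unfolding P_def by (rule matching_graph[OF inj_on_subset[OF \<sigma>(1)]]) (auto simp: I_def)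
  have "sum ?g {m..<L} = sum ?g I" unfolding I_def by (intro sum.mono_neutral_right) auto
  then have PW: "1/2 \<le> wsum w p P z" using half by (simp add: P_def wsum_graph)
  have zm: "z k = 0" if "k < m" for k using y(1) that by (simp add: Y_from_def z_def)
  have Pm: "m \<le> \<sigma> i" if "i \<in> I" for i using that zm[of "\<sigma> i"] by (cases "\<sigma> i < m") (auto simp: I_def)
  have "\<forall>\<^sub>F n in sequentially. (\<forall>Q. matching Q \<longrightarrow> fst ` Q \<subseteq> {n..} \<longrightarrow> wsum w p Q y \<le> \<delta>) \<and>
      (\<forall>Q. matching Q \<longrightarrow> fst ` Q \<subseteq> {n..} \<longrightarrow> wsum w p Q z \<le> \<delta>)"
    by (intro eventually_conj small_tail yd zd assms)
  then obtain N where N: "\<And>n Q. n \<ge> N \<Longrightarrow> matching Q \<Longrightarrow> fst ` Q \<subseteq> {n..} \<Longrightarrow>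
      wsum w p Q y \<le> \<delta> \<and> wsum w p Q z \<le> \<delta>" unfolding eventually_sequentially by blast
  have "finite (\<sigma> ` I)" by (simp add: I_def)
  then obtain b where b: "\<sigma> ` I \<subseteq> {..<b}" using finite_nat_iff_bounded by blast
  \<comment> \<open>Beyond all coordinates and ranks used by \<open>P\<close>, and far enough out
    for both tails to be small.\<close>
  define m' where "m' = Max {Suc m, N, L, b}"
  have m': "m < m'" "N \<le> m'" "L \<le> m'" "b \<le> m'" by (auto simp: m'_def)
  have "fst ` P \<subseteq> {m..<m'}" using b Pm m'(4) by (force simp: P_def)
  moreover have "snd ` P \<subseteq> {m..<m'}" using m'(3) by (auto simp: P_def I_def)
  moreover have "\<forall>q\<in>P. z (fst q) \<noteq> 0" by (auto simp: P_def I_def)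
  moreover have "\<forall>Q. matching Q \<longrightarrow> fst ` Q \<subseteq> {m'..} \<longrightarrow> wsum w p Q y \<le> \<delta> \<and> wsum w p Q z \<le> \<delta>"
    using N[OF m'(2)] by blast
  ultimately show ?thesis using y(1,2) m'(1) PM PW unfolding z_def by blast
qed

end

subsection \<open>Inverting the triangular matrix\<close>

text \<open>Forward substitution for a lower triangular system with unit diagonal; entries of
  \<open>M\<close> on or above the diagonal are never read.\<close>

fun solve :: "(nat \<Rightarrow> nat \<Rightarrow> real) \<Rightarrow> (nat \<Rightarrow> real) \<Rightarrow> nat \<Rightarrow> real" where
  "solve M b j = b j - (\<Sum>i<j. M j i * solve M b i)"

declare solve.simps [simp del]

text \<open>This uniqueness yields both the linearity of \<open>solve\<close> and its role as an
  inverse.\<close>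

lemma solve_unique:
  assumes "\<And>j. b j = x j + (\<Sum>i<j. M j i * x i)"
  shows "solve M b = x"
proof
  fix j show "solve M b j = x j"
  proof (induction j rule: less_induct)
    case (less j)
    have "solve M b j = b j - (\<Sum>i<j. M j i * x i)"
      unfolding solve.simps[of M b j] using less by simp
    then show ?case using assms[of j] by simp
  qed
qed

lemma solve_eq: "b j = solve M b j + (\<Sum>i<j. M j i * solve M b i)"
  by (simp add: solve.simps[of M b j])

lemma solve_add: "solve M (\<lambda>j. a j + b j) = (\<lambda>j. solve M a j + solve M b j)"
  by (rule solve_unique)
    (use solve_eq[of a _ M] solve_eq[of b _ M] in \<open>simp add: distrib_left sum.distrib\<close>)

lemma solve_scale: "solve M (\<lambda>j. c * b j) = (\<lambda>j. c * solve M b j)"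
proof (rule solve_unique)
  fix j
  have "c * b j = c * (solve M b j + (\<Sum>i<j. M j i * solve M b i))" using solve_eq[of b j M] by simp
  then show "c * b j = c * solve M b j + (\<Sum>i<j. M j i * (c * solve M b i))"
    by (simp add: distrib_left sum_distrib_left mult_ac)
qed

text \<open>After exchanging the order of summation, the column bounds make the off-diagonal
  contribution at most half of the left-hand side, which is a finite sum and can absorb it.\<close>

lemma solve_bound:
  fixes p :: real
  assumes "1 \<le> p"
    and column: "\<And>i n. (\<Sum>j\<in>{i<..<n}. \<bar>M j i\<bar> powr p) \<le> 1 / (2 * (2 powr p) ^ (i + 2))"
  shows "(\<Sum>j<n. \<bar>solve M b j\<bar> powr p) \<le> 2 * 2 powr p * (\<Sum>j<n. \<bar>b j\<bar> powr p)"
proof -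
  define C :: real where "C = 2 powr p"
  have C: "C > 0" by (simp add: C_def)
  let ?a = "solve M b"
  have "(\<Sum>j<n. \<bar>?a j\<bar> powr p) \<le> (\<Sum>j<n. C * \<bar>b j\<bar> powr p + C * (\<Sum>i<j. C ^ Suc i * (\<bar>M j i\<bar> powr p * \<bar>?a i\<bar> powr p)))"
  proof (intro sum_mono)
    fix j
    have "\<bar>?a j\<bar> powr p \<le> C * (\<bar>b j\<bar> powr p + \<bar>- (\<Sum>i<j. M j i * ?a i)\<bar> powr p)"
      using abs_add_powr_le[OF assms(1), of "b j" "- (\<Sum>i<j. M j i * ?a i)"]
      by (simp add: C_def solve.simps[of M b j])
    also have "\<bar>- (\<Sum>i<j. M j i * ?a i)\<bar> powr p \<le> (\<Sum>i<j. C ^ Suc i * (\<bar>M j i\<bar> powr p * \<bar>?a i\<bar> powr p))"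
      using abs_sum_powr_le[OF assms(1), of "\<lambda>i. M j i * ?a i" j]
      by (simp add: C_def abs_mult powr_mult)
    finally show "\<bar>?a j\<bar> powr p \<le> C * \<bar>b j\<bar> powr p + C * (\<Sum>i<j. C ^ Suc i * (\<bar>M j i\<bar> powr p * \<bar>?a i\<bar> powr p))"
      using C by (simp add: distrib_left)
  qed
  also have "\<dots> = C * (\<Sum>j<n. \<bar>b j\<bar> powr p)
      + C * (\<Sum>j<n. \<Sum>i<j. C ^ Suc i * (\<bar>M j i\<bar> powr p * \<bar>?a i\<bar> powr p))"
    by (simp only: sum.distrib sum_distrib_left)
  also have "(\<Sum>j<n. \<Sum>i<j. C ^ Suc i * (\<bar>M j i\<bar> powr p * \<bar>?a i\<bar> powr p))
      = (\<Sum>i<n. \<Sum>j\<in>{i<..<n}. C ^ Suc i * (\<bar>M j i\<bar> powr p * \<bar>?a i\<bar> powr p))"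
    unfolding sum.Sigma[OF finite_lessThan ballI[OF finite_lessThan]]
      sum.Sigma[OF finite_lessThan ballI[OF finite_greaterThanLessThan]]
    by (rule sum.reindex_bij_witness[of _ "\<lambda>(i,j). (j,i)" "\<lambda>(j,i). (i,j)"]) auto
  also have "\<dots> = (\<Sum>i<n. C ^ Suc i * \<bar>?a i\<bar> powr p * (\<Sum>j\<in>{i<..<n}. \<bar>M j i\<bar> powr p))"
    by (simp add: sum_distrib_left mult_ac)
  also have "\<dots> \<le> (\<Sum>i<n. C ^ Suc i * \<bar>?a i\<bar> powr p * (1 / (2 * C ^ (i + 2))))"
    using column C by (intro sum_mono mult_left_mono) (auto simp: C_def)
  also have "\<dots> = (\<Sum>i<n. \<bar>?a i\<bar> powr p / (2 * C))"
    using C by (intro sum.cong) (auto simp: field_simps)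
  \<comment> \<open>The exponent \<open>i + 2\<close> in the column bound cancels
    \<open>C ^ Suc i\<close> and the outer \<open>C\<close>, leaving exactly one half.\<close>
  also have "C * (\<Sum>i<n. \<bar>?a i\<bar> powr p / (2 * C)) = (\<Sum>i<n. \<bar>?a i\<bar> powr p) / 2"
    using C by (simp add: sum_divide_distrib[symmetric])
  finally show ?thesis using C by (simp add: C_def mult_left_mono)
qed

lemma bounded_op_comp:
  assumes F: "bounded_op X nX V nV F" and G: "bounded_op V nV Z nZ G"
    and nn: "\<And>v. V v \<Longrightarrow> 0 \<le> nV v"
  shows "bounded_op X nX Z nZ (\<lambda>x. G (F x))"
proof -
  obtain a where a: "\<And>x. X x \<Longrightarrow> nV (F x) \<le> a * nX x" using F by (auto simp: bounded_op_def)
  obtain b where b: "\<And>v. V v \<Longrightarrow> nZ (G v) \<le> b * nV v" using G by (auto simp: bounded_op_def)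
  have FV: "V (F x)" if "X x" for x using F that by (simp add: bounded_op_def)
  \<comment> \<open>The constant \<open>b\<close> may be negative, hence the absolute value.\<close>
  have "nZ (G (F x)) \<le> \<bar>b\<bar> * a * nX x" if "X x" for x
  proof -
    have "nZ (G (F x)) \<le> \<bar>b\<bar> * nV (F x)"
      using b[OF FV[OF that]] nn[OF FV[OF that]] by (meson abs_ge_self mult_right_mono order_trans)
    also have "\<dots> \<le> \<bar>b\<bar> * (a * nX x)" using a[OF that] by (intro mult_left_mono) auto
    finally show ?thesis by simp
  qed
  then show ?thesis using F G unfolding bounded_op_def by auto
qed

subsection \<open>Factoring the identity of \<open>\<ell>\<^sub>p\<close>\<close>

text \<open>The numbers \<open>m j\<close> cut coordinates and ranks into blocks simultaneously. The
  tail bounds offset the losses of \<open>abs_sum_powr_le\<close>, and twice the bound for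
  \<open>T (y j)\<close> is the column bound of \<open>solve_bound\<close>.\<close>

locale lorentz_blocks = lorentz +
  fixes T :: "(nat \<Rightarrow> real) \<Rightarrow> (nat \<Rightarrow> real)" and y :: "nat \<Rightarrow> nat \<Rightarrow> real"
    and m :: "nat \<Rightarrow> nat" and P :: "nat \<Rightarrow> (nat \<times> nat) set" and K :: real
  assumes T: "T \<in> L_dwp w p"
    and m_less: "m j < m (Suc j)"
    and y_dwp: "in_dwp w p (y j)" and y_norm: "norm_pow w p (y j) \<le> K"
    and y_zero: "k < m j \<Longrightarrow> y j k = 0" and Ty_zero: "k < m j \<Longrightarrow> T (y j) k = 0"
    and P_matching: "matching (P j)" and P_fst: "fst ` P j \<subseteq> {m j..<m (Suc j)}"
    and P_snd: "snd ` P j \<subseteq> {m j..<m (Suc j)}"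
    and P_wsum: "1/2 \<le> wsum w p (P j) (T (y j))"
    and P_nonzero: "q \<in> P j \<Longrightarrow> T (y j) (fst q) \<noteq> 0"
    and y_tail: "matching Q \<Longrightarrow> fst ` Q \<subseteq> {m (Suc j)..} \<Longrightarrow> wsum w p Q (y j) \<le> 1 / (4 * (2 powr p) ^ (j + 2))"
    and Ty_tail: "matching Q \<Longrightarrow> fst ` Q \<subseteq> {m (Suc j)..} \<Longrightarrow> wsum w p Q (T (y j)) \<le> 1 / (4 * (2 powr p) ^ (j + 2))"
begin

abbreviation z :: "nat \<Rightarrow> nat \<Rightarrow> real" where "z j \<equiv> T (y j)"

lemma
  shows T_dwp: "in_dwp w p x \<Longrightarrow> in_dwp w p (T x)"
    and T_add: "in_dwp w p x \<Longrightarrow> in_dwp w p v \<Longrightarrow> T (\<lambda>k. x k + v k) = (\<lambda>k. T x k + T v k)"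
    and T_scale: "in_dwp w p x \<Longrightarrow> T (\<lambda>k. a * x k) = (\<lambda>k. a * T x k)"
  using T unfolding L_dwp_def bounded_op_def by auto

lemma m_strict_mono: "strict_mono m"
  using m_less by (rule strict_mono_Suc_iff[THEN iffD2, rule_format])

lemma le_m: "j \<le> m j"
  by (rule strict_mono_imp_increasing[OF m_strict_mono])

lemma less_m: "k < j \<Longrightarrow> k < m j"
  using le_m[of j] by simp

lemma m_Suc_le: "i < j \<Longrightarrow> m (Suc i) \<le> m j"
  using strict_mono_mono[OF m_strict_mono] by (simp add: monoD Suc_le_eq)

lemma block_unique:
  assumes "m i \<le> k" "k < m (Suc i)" "m j \<le> k" "k < m (Suc j)"
  shows "i = j"
  using assms m_Suc_le[of i j] m_Suc_le[of j i] by (cases i j rule: linorder_cases) auto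

text \<open>Blocks are disjoint both in coordinates and in ranks, so the union is again a matching.
  This gives the lower \<open>p\<close>-estimate behind \<open>to_lp\<close>.\<close>

lemma matching_UN:
  assumes "finite J"
  shows "matching (\<Union>j\<in>J. P j)" and "wsum w p (\<Union>j\<in>J. P j) x = (\<Sum>j\<in>J. wsum w p (P j) x)"
proof -
  have fin: "finite (P j)" and inj: "inj_on fst (P j)" "inj_on snd (P j)" for j
    using P_matching[of j] by (auto simp: matching_def)
  have rng: "m j \<le> fst q" "fst q < m (Suc j)" "m j \<le> snd q" "snd q < m (Suc j)" if "q \<in> P j" for j q
    using P_fst[of j] P_snd[of j] that by force+
  have "inj_on fst (\<Union>j\<in>J. P j)"
  proof (rule inj_onI)
    fix q r assume "q \<in> (\<Union>j\<in>J. P j)" "r \<in> (\<Union>j\<in>J. P j)" and eq: "fst q = fst r"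
    then obtain i j where ij: "q \<in> P i" "r \<in> P j" by auto
    then have "i = j" using rng[OF ij(1)] rng[OF ij(2)] eq by (intro block_unique[of i "fst q" j]) auto
    then show "q = r" using inj(1)[of j] ij eq by (auto dest: inj_onD)
  qed
  moreover have "inj_on snd (\<Union>j\<in>J. P j)"
  proof (rule inj_onI)
    fix q r assume "q \<in> (\<Union>j\<in>J. P j)" "r \<in> (\<Union>j\<in>J. P j)" and eq: "snd q = snd r"
    then obtain i j where ij: "q \<in> P i" "r \<in> P j" by auto
    then have "i = j" using rng[OF ij(1)] rng[OF ij(2)] eq by (intro block_unique[of i "snd q" j]) auto
    then show "q = r" using inj(2)[of j] ij eq by (auto dest: inj_onD)
  qed
  ultimately show "matching (\<Union>j\<in>J. P j)" using assms fin by (simp add: matching_def)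
  have "P i \<inter> P j = {}" if "i \<noteq> j" for i j
  proof (rule ccontr)
    assume "P i \<inter> P j \<noteq> {}"
    then obtain q where q: "q \<in> P i" "q \<in> P j" by auto
    show False using block_unique[OF rng(1,2)[OF q(1)] rng(1,2)[OF q(2)]] that by simp
  qed
  then show "wsum w p (\<Union>j\<in>J. P j) x = (\<Sum>j\<in>J. wsum w p (P j) x)"
    unfolding wsum_def using assms fin by (intro sum.UNION_disjoint) auto
qed

text \<open>Relative share of \<open>q\<close> in the matching sum of \<open>z j\<close>. The factor
  \<open>\<bar>z j (fst q)\<bar> powr p\<close> is there to cancel the denominator of the quotients
  averaged below.\<close>

definition coef :: "nat \<Rightarrow> (nat \<times> nat) \<Rightarrow> real" where
  "coef j q = w (snd q) * \<bar>z j (fst q)\<bar> powr p / wsum w p (P j) (z j)"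

text \<open>The average of the quotients \<open>x k / z j k\<close> over the \<open>j\<close>-th block; by convexity of
  the power function its \<open>p\<close>-th power is controlled by the matching sum.\<close>

definition functional :: "nat \<Rightarrow> (nat \<Rightarrow> real) \<Rightarrow> real" where
  "functional j x = (\<Sum>q\<in>P j. coef j q * (x (fst q) / z j (fst q)))"

lemma coef_nonneg: "0 \<le> coef j q"
  using w_nonneg P_wsum[of j] by (simp add: coef_def)

lemma sum_coef: "(\<Sum>q\<in>P j. coef j q) = 1"
  using P_wsum[of j] by (simp add: coef_def sum_divide_distrib[symmetric] wsum_def[symmetric])

lemma functional_self: "functional j (z j) = 1"
  using P_nonzero by (simp add: functional_def sum_coef)

text \<open>Jensen, then cancellation of the powers of \<open>z j\<close>; the factor 2 comes from
  \<open>P_wsum\<close>.\<close>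

lemma functional_bound: "\<bar>functional j x\<bar> powr p \<le> 2 * wsum w p (P j) x"
proof -
  have "\<bar>functional j x\<bar> powr p \<le> (\<Sum>q\<in>P j. coef j q * \<bar>x (fst q) / z j (fst q)\<bar> powr p)"
    unfolding functional_def using P_matching[of j] coef_nonneg sum_coef
    by (intro weighted_mean_powr[OF p_ge_1]) (auto simp: matching_def)
  also have "\<dots> = (\<Sum>q\<in>P j. w (snd q) * \<bar>x (fst q)\<bar> powr p / wsum w p (P j) (z j))"
    using P_nonzero[of _ j] by (intro sum.cong) (auto simp: coef_def powr_divide abs_divide)
  also have "\<dots> = wsum w p (P j) x / wsum w p (P j) (z j)"
    by (simp add: wsum_def sum_divide_distrib)
  also have "\<dots> \<le> wsum w p (P j) x / (1/2)"
    using P_wsum[of j] wsum_nonneg by (intro divide_left_mono) auto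
  finally show ?thesis by simp
qed

lemma functional_add: "functional j (\<lambda>k. x k + v k) = functional j x + functional j v"
  by (simp add: functional_def sum.distrib[symmetric] add_divide_distrib distrib_left)

lemma functional_scale: "functional j (\<lambda>k. a * x k) = a * functional j x"
  by (simp add: functional_def sum_distrib_left mult_ac)

lemma functional_sum:
  assumes "finite J"
  shows "(\<Sum>j\<in>J. \<bar>functional j x\<bar> powr p) \<le> 2 * wsum w p (\<Union>j\<in>J. P j) x"
  unfolding matching_UN(2)[OF assms] sum_distrib_left by (intro sum_mono functional_bound)

text \<open>The functionals alone send the \<open>z i\<close> to the columns of a triangular matrix
  with unit diagonal; \<open>solve\<close> undoes that matrix.\<close>

definition to_lp :: "(nat \<Rightarrow> real) \<Rightarrow> (nat \<Rightarrow> real)" where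
  "to_lp x = solve (\<lambda>j i. functional j (z i)) (\<lambda>j. functional j x)"

text \<open>This is the infinite series of the \<open>x i * y i\<close>: at coordinate
  \<open>k\<close> its terms with \<open>i > k\<close> vanish, because
  \<open>k < i \<le> m i\<close>.\<close>

definition from_lp :: "(nat \<Rightarrow> real) \<Rightarrow> (nat \<Rightarrow> real)" where
  "from_lp x = (\<lambda>k. \<Sum>i\<le>k. x i * y i k)"

text \<open>Blocks after the \<open>i\<close>-th meet only the tail of \<open>z i\<close>, which
  supplies the column bounds for \<open>solve_bound\<close>.\<close>

lemma to_lp_bound:
  assumes "in_dwp w p x"
  shows "(\<Sum>j<n. \<bar>to_lp x j\<bar> powr p) \<le> 4 * 2 powr p * norm_pow w p x"
proof -
  have "(\<Sum>j\<in>{i<..<n}. \<bar>functional j (z i)\<bar> powr p) \<le> 1 / (2 * (2 powr p) ^ (i + 2))" for i n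
  proof -
    have "fst ` (\<Union>j\<in>{i<..<n}. P j) \<subseteq> {m (Suc i)..}"
      using P_fst m_Suc_le by (fastforce dest: subsetD)
    then have "wsum w p (\<Union>j\<in>{i<..<n}. P j) (z i) \<le> 1 / (4 * (2 powr p) ^ (i + 2))"
      by (intro Ty_tail matching_UN) auto
    then show ?thesis using functional_sum[of "{i<..<n}" "z i"] by simp
  qed
  then have "(\<Sum>j<n. \<bar>to_lp x j\<bar> powr p) \<le> 2 * 2 powr p * (\<Sum>j<n. \<bar>functional j x\<bar> powr p)"
    unfolding to_lp_def by (rule solve_bound[OF p_ge_1])
  also have "\<dots> \<le> 2 * 2 powr p * (2 * wsum w p (\<Union>j\<in>{..<n}. P j) x)"
    by (intro mult_left_mono functional_sum) auto
  also have "\<dots> \<le> 2 * 2 powr p * (2 * norm_pow w p x)"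
    by (intro mult_left_mono wsum_le_norm_pow[OF assms] matching_UN) auto
  finally show ?thesis by simp
qed

lemma bounded_op_to_lp: "bounded_op (in_dwp w p) (norm_dwp w p) (in_lp p) (norm_lp p) to_lp"
proof -
  define C :: real where "C = 4 * 2 powr p"
  have *: "in_lp p (to_lp x) \<and> norm_lp p (to_lp x) \<le> C powr (1/p) * norm_dwp w p x"
    if x: "in_dwp w p x" for x
  proof -
    have le: "(\<Sum>j<n. \<bar>to_lp x j\<bar> powr p) \<le> C * norm_pow w p x" for n
      using to_lp_bound[OF x] by (simp add: C_def)
    then have sm: "summable (\<lambda>j. \<bar>to_lp x j\<bar> powr p)"
      by (intro bounded_imp_summable[where B = "C * norm_pow w p x"])
        (auto simp: lessThan_Suc_atMost[symmetric] simp del: sum.lessThan_Suc)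
    have "norm_lp p (to_lp x) \<le> (C * norm_pow w p x) powr (1/p)"
      unfolding norm_lp_def using p_ge_1 suminf_le_const[OF sm le] sm
      by (intro powr_mono2) (auto intro!: suminf_nonneg)
    then show ?thesis using sm norm_pow_nonneg[OF x]
      by (simp add: in_lp_def norm_dwp_eq powr_mult C_def)
  qed
  moreover have "to_lp (\<lambda>k. x k + v k) = (\<lambda>k. to_lp x k + to_lp v k)" for x v
    by (simp add: to_lp_def functional_add solve_add)
  moreover have "to_lp (\<lambda>k. a * x k) = (\<lambda>k. a * to_lp x k)" for a x
    by (simp add: to_lp_def functional_scale solve_scale)
  ultimately show ?thesis unfolding bounded_op_def by blast
qed

section \<open>Boundedness of the synthesis operator \<open>from_lp\<close>\<close>

lemma K_nonneg: "0 \<le> K"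
  using norm_pow_nonneg[OF y_dwp] y_norm by (rule order_trans)

lemma from_lp_eq:
  assumes "k < n"
  shows "from_lp x k = (\<Sum>i<n. x i * y i k)"
  unfolding from_lp_def using assms
  by (intro sum.mono_neutral_left) (auto simp: y_zero less_m)

text \<open>The decay of the tails compensates the factor with which \<open>abs_sum_powr_le\<close>
  charges the \<open>i\<close>-th term.\<close>

lemma y_tail_sum:
  assumes "matching Q"
  shows "(2 powr p) ^ Suc i * (\<Sum>q\<in>Q. w (snd q) * (if m (Suc i) \<le> fst q then \<bar>y i (fst q)\<bar> powr p else 0)) \<le> 1"
proof -
  define C :: real where "C = 2 powr p"
  have C: "1 \<le> C" using p_ge_1 by (simp add: C_def ge_one_powr_ge_zero)
  have "(\<Sum>q\<in>Q. w (snd q) * (if m (Suc i) \<le> fst q then \<bar>y i (fst q)\<bar> powr p else 0))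
      = wsum w p {q\<in>Q. m (Suc i) \<le> fst q} (y i)"
    unfolding wsum_def using assms by (intro sum.mono_neutral_cong_right) (auto simp: matching_def)
  also have "\<dots> \<le> 1 / (4 * C ^ (i + 2))"
    unfolding C_def using matching_subset[OF assms] by (intro y_tail) auto
  finally have "C ^ Suc i * (\<Sum>q\<in>Q. w (snd q) * (if m (Suc i) \<le> fst q then \<bar>y i (fst q)\<bar> powr p else 0))
      \<le> C ^ Suc i * (1 / (4 * C ^ (i + 2)))" using C by (intro mult_left_mono) auto
  also have "\<dots> = 1 / (4 * C)" using C by (simp add: field_simps)
  also have "\<dots> \<le> 1" using C by simp
  finally show ?thesis by (simp only: C_def)
qed

text \<open>At each coordinate at most one \<open>y i\<close> contributes its main part; everything else consists of tails.\<close>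

lemma from_lp_wsum:
  assumes x: "in_lp p x" and Q: "matching Q"
  shows "wsum w p Q (from_lp x) \<le> 2 powr p * (K + 1) * (\<Sum>i. \<bar>x i\<bar> powr p)"
proof -
  define C :: real where "C = 2 powr p"
  have C: "C > 0" by (simp add: C_def)
  have sm: "summable (\<lambda>i. \<bar>x i\<bar> powr p)" using x by (simp add: in_lp_def)
  have "finite (fst ` Q)" using Q by (simp add: matching_def)
  then obtain n where n: "fst ` Q \<subseteq> {..<n}" using finite_nat_iff_bounded by blast
  define tl where "tl i k = (if m (Suc i) \<le> k then \<bar>y i k\<bar> powr p else 0)" for i k
  have pt: "\<bar>from_lp x k\<bar> powr p \<le> C * ((\<Sum>i<n. \<bar>x i\<bar> powr p * \<bar>y i k\<bar> powr p)
      + (\<Sum>i<n. \<bar>x i\<bar> powr p * (C ^ Suc i * tl i k)))" if "k < n" for k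
  proof -
    \<comment> \<open>\<open>u\<close> collects main parts, \<open>v\<close> tails. Since
      \<open>y i\<close> vanishes before \<open>m i\<close>, a nonzero \<open>u i\<close> puts
      \<open>k\<close> into block \<open>i\<close>, so at most one \<open>u i\<close> is
      nonzero.\<close>
    define u where "u i = (if k < m (Suc i) then x i * y i k else 0)" for i
    define v where "v i = (if m (Suc i) \<le> k then x i * y i k else 0)" for i
    have "from_lp x k = (\<Sum>i<n. u i + v i)"
      unfolding from_lp_eq[OF that] by (intro sum.cong) (auto simp: u_def v_def)
    then have "\<bar>from_lp x k\<bar> powr p \<le> C * (\<bar>\<Sum>i<n. u i\<bar> powr p + \<bar>\<Sum>i<n. v i\<bar> powr p)"
      unfolding C_def using abs_add_powr_le[OF p_ge_1] by (simp add: sum.distrib)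
    also have "\<bar>\<Sum>i<n. u i\<bar> powr p = (\<Sum>i<n. \<bar>u i\<bar> powr p)"
    proof (rule abs_sum_powr_single)
      fix i j assume "u i \<noteq> 0" "u j \<noteq> 0"
      then show "i = j" using y_zero[of k i] y_zero[of k j]
        by (intro block_unique[of i k j]) (auto simp: u_def not_less[symmetric] split: if_splits)
    qed simp
    also have "\<dots> \<le> (\<Sum>i<n. \<bar>x i\<bar> powr p * \<bar>y i k\<bar> powr p)"
      by (intro sum_mono) (auto simp: u_def abs_mult powr_mult)
    also have "\<bar>\<Sum>i<n. v i\<bar> powr p \<le> (\<Sum>i<n. C ^ Suc i * \<bar>v i\<bar> powr p)"
      unfolding C_def by (rule abs_sum_powr_le[OF p_ge_1])
    also have "\<dots> = (\<Sum>i<n. \<bar>x i\<bar> powr p * (C ^ Suc i * tl i k))"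
      by (intro sum.cong) (auto simp: v_def tl_def abs_mult powr_mult)
    finally show ?thesis using C by simp
  qed
  have "wsum w p Q (from_lp x) \<le> (\<Sum>q\<in>Q. w (snd q) * (C * ((\<Sum>i<n. \<bar>x i\<bar> powr p * \<bar>y i (fst q)\<bar> powr p)
      + (\<Sum>i<n. \<bar>x i\<bar> powr p * (C ^ Suc i * tl i (fst q))))))"
    unfolding wsum_def using n w_nonneg by (intro sum_mono mult_left_mono pt) auto
  also have "\<dots> = C * ((\<Sum>q\<in>Q. \<Sum>i<n. \<bar>x i\<bar> powr p * (w (snd q) * \<bar>y i (fst q)\<bar> powr p))
      + (\<Sum>q\<in>Q. \<Sum>i<n. \<bar>x i\<bar> powr p * (C ^ Suc i * (w (snd q) * tl i (fst q)))))"
    by (simp add: sum.distrib[symmetric] sum_distrib_left distrib_left mult_ac)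
  also have "(\<Sum>q\<in>Q. \<Sum>i<n. \<bar>x i\<bar> powr p * (w (snd q) * \<bar>y i (fst q)\<bar> powr p))
      = (\<Sum>i<n. \<bar>x i\<bar> powr p * wsum w p Q (y i))"
    unfolding wsum_def sum_distrib_left by (rule sum.swap)
  also have "\<dots> \<le> (\<Sum>i<n. \<bar>x i\<bar> powr p * K)"
    by (intro sum_mono mult_left_mono order_trans[OF wsum_le_norm_pow[OF y_dwp Q] y_norm]) auto
  also have "(\<Sum>q\<in>Q. \<Sum>i<n. \<bar>x i\<bar> powr p * (C ^ Suc i * (w (snd q) * tl i (fst q))))
      = (\<Sum>i<n. \<bar>x i\<bar> powr p * (C ^ Suc i * (\<Sum>q\<in>Q. w (snd q) * tl i (fst q))))"
    unfolding sum_distrib_left by (rule sum.swap)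
  also have "\<dots> \<le> (\<Sum>i<n. \<bar>x i\<bar> powr p * 1)"
    using y_tail_sum[OF Q] by (intro sum_mono mult_left_mono) (auto simp: C_def tl_def)
  also have "(\<Sum>i<n. \<bar>x i\<bar> powr p * K) + (\<Sum>i<n. \<bar>x i\<bar> powr p * 1) = (K + 1) * (\<Sum>i<n. \<bar>x i\<bar> powr p)"
    by (simp only: sum_distrib_right[symmetric]) (simp add: algebra_simps)
  also have "\<dots> \<le> (K + 1) * (\<Sum>i. \<bar>x i\<bar> powr p)"
    using K_nonneg by (intro mult_left_mono sum_le_suminf[OF sm]) auto
  finally show ?thesis using C by (simp add: C_def mult.assoc)
qed

lemma from_lp_dwp: "in_lp p x \<Longrightarrow> in_dwp w p (from_lp x)"
  and from_lp_norm_pow: "in_lp p x \<Longrightarrow> norm_pow w p (from_lp x) \<le> 2 powr p * (K + 1) * (\<Sum>i. \<bar>x i\<bar> powr p)"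
  using in_dwpI[OF from_lp_wsum] by auto

lemma from_lp_norm:
  assumes "in_lp p x"
  shows "norm_dwp w p (from_lp x) \<le> (2 powr p * (K + 1)) powr (1/p) * norm_lp p x"
proof -
  have "0 \<le> (\<Sum>i. \<bar>x i\<bar> powr p)" using assms by (intro suminf_nonneg) (auto simp: in_lp_def)
  moreover have "norm_dwp w p (from_lp x) \<le> (2 powr p * (K + 1) * (\<Sum>i. \<bar>x i\<bar> powr p)) powr (1/p)"
    unfolding norm_dwp_eq using p_ge_1 from_lp_norm_pow[OF assms] norm_pow_nonneg[OF from_lp_dwp[OF assms]]
    by (intro powr_mono2) auto
  ultimately show ?thesis using K_nonneg by (simp add: norm_lp_def powr_mult)
qed

lemma from_lp_add: "from_lp (\<lambda>i. x i + v i) = (\<lambda>k. from_lp x k + from_lp v k)"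
  by (simp add: from_lp_def distrib_right sum.distrib)

lemma from_lp_scale: "from_lp (\<lambda>i. a * x i) = (\<lambda>k. a * from_lp x k)"
  by (simp add: from_lp_def sum_distrib_left mult_ac)

lemma bounded_op_from_lp: "bounded_op (in_lp p) (norm_lp p) (in_dwp w p) (norm_dwp w p) from_lp"
  unfolding bounded_op_def
  by (intro conjI allI impI exI[of _ "(2 powr p * (K + 1)) powr (1/p)"]
      from_lp_dwp from_lp_norm from_lp_add from_lp_scale)

text \<open>Linearity of \<open>T\<close> covers only finite sums. The remainder is the image of a
  tail of \<open>x\<close>, which tends to 0 in norm, hence in each coordinate, by boundedness of
  \<open>T\<close> and \<open>from_lp\<close>.\<close>

lemma T_from_lp:
  assumes x: "in_lp p x"
  shows "T (from_lp x) k = (\<Sum>i\<le>k. x i * z i k)"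
proof -
  obtain C where C: "\<And>x. in_dwp w p x \<Longrightarrow> norm_dwp w p (T x) \<le> C * norm_dwp w p x"
    using T by (auto simp: L_dwp_def bounded_op_def)
  define B where "B = (2 powr p * (K + 1)) powr (1/p)"
  define tl where "tl n i = (if i < n then 0 else x i)" for n i
  have sm: "summable (\<lambda>i. \<bar>x i\<bar> powr p)" using x by (simp add: in_lp_def)
  have tl_suminf: "(\<lambda>i. \<bar>tl n i\<bar> powr p) sums ((\<Sum>i. \<bar>x i\<bar> powr p) - (\<Sum>i<n. \<bar>x i\<bar> powr p))" for n
  proof -
    have "(\<lambda>i. if i \<in> {..<n} then \<bar>x i\<bar> powr p else 0) sums (\<Sum>i<n. \<bar>x i\<bar> powr p)"
      by (rule sums_If_finite_set) simp
    from sums_diff[OF summable_sums[OF sm] this] show ?thesis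
      by (rule sums_cong[THEN iffD1, rotated]) (auto simp: tl_def)
  qed
  have tl_lp: "in_lp p (tl n)" for n using sums_summable[OF tl_suminf] by (simp add: in_lp_def)
  have split: "from_lp x = (\<lambda>j. from_lp (tl n) j + (\<Sum>i<n. x i * y i j))" for n
  proof
    fix j
    \<comment> \<open>Any upper limit above \<open>j\<close> is allowed here; the maximum also makes
      room for the first \<open>n\<close> terms.\<close>
    have "from_lp x j = (\<Sum>i<max n (Suc j). x i * y i j)" by (rule from_lp_eq) simp
    also have "\<dots> = (\<Sum>i<max n (Suc j). tl n i * y i j) + (\<Sum>i<max n (Suc j). (if i < n then x i * y i j else 0))"
      unfolding sum.distrib[symmetric] by (intro sum.cong) (auto simp: tl_def)
    also have "(\<Sum>i<max n (Suc j). tl n i * y i j) = from_lp (tl n) j" by (rule from_lp_eq[symmetric]) simp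
    also have "(\<Sum>i<max n (Suc j). (if i < n then x i * y i j else 0)) = (\<Sum>i<n. x i * y i j)"
      by (intro sum.mono_neutral_cong_right) auto
    finally show "from_lp x j = from_lp (tl n) j + (\<Sum>i<n. x i * y i j)" .
  qed
  have comb: "in_dwp w p (\<lambda>k. \<Sum>i<n. x i * y i k)" "T (\<lambda>k. \<Sum>i<n. x i * y i k) = (\<lambda>k. \<Sum>i<n. x i * z i k)" for n
    using linear_combination[where V = "{x. in_dwp w p x}" and T = T and I = "{..<n}" and f = y and c = x]
      in_dwp_zero in_dwp_add in_dwp_scale T_add T_scale y_dwp by auto
  have bound: "\<bar>T (from_lp x) k - (\<Sum>i\<le>k. x i * z i k)\<bar> \<le> \<bar>C\<bar> * (B * norm_lp p (tl n))" if "k < n" for n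
  proof -
    have "T (from_lp x) k = T (from_lp (tl n)) k + (\<Sum>i<n. x i * z i k)"
      by (subst split[of n], subst T_add[OF from_lp_dwp[OF tl_lp] comb(1)]) (simp add: comb(2))
    moreover have "(\<Sum>i\<le>k. x i * z i k) = (\<Sum>i<n. x i * z i k)"
      using that by (intro sum.mono_neutral_left) (auto simp: Ty_zero less_m)
    ultimately have "\<bar>T (from_lp x) k - (\<Sum>i\<le>k. x i * z i k)\<bar> = \<bar>T (from_lp (tl n)) k\<bar>" by simp
    also have "\<dots> \<le> norm_dwp w p (T (from_lp (tl n)))"
      by (rule coord_le_norm[OF T_dwp[OF from_lp_dwp[OF tl_lp]]])
    also have "\<dots> \<le> C * norm_dwp w p (from_lp (tl n))" by (rule C[OF from_lp_dwp[OF tl_lp]])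
    also have "\<dots> \<le> \<bar>C\<bar> * norm_dwp w p (from_lp (tl n))" by (intro mult_right_mono) (auto simp: norm_dwp_def)
    also have "\<dots> \<le> \<bar>C\<bar> * (B * norm_lp p (tl n))"
      unfolding B_def by (intro mult_left_mono from_lp_norm[OF tl_lp]) auto
    finally show ?thesis .
  qed
  define r where "r n = (\<Sum>i. \<bar>x i\<bar> powr p) - (\<Sum>i<n. \<bar>x i\<bar> powr p)" for n
  have "r \<longlonglongrightarrow> (\<Sum>i. \<bar>x i\<bar> powr p) - (\<Sum>i. \<bar>x i\<bar> powr p)"
    unfolding r_def by (intro tendsto_diff tendsto_const summable_LIMSEQ[OF sm])
  then have r: "r \<longlonglongrightarrow> 0" by simp
  have "0 \<le> r n" for n unfolding r_def using sum_le_suminf[OF sm, of "{..<n}"] by simp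
  then have "(\<lambda>n. r n powr (1/p)) \<longlonglongrightarrow> 0 powr (1/p)"
    using p_ge_1 by (intro tendsto_powr'[OF r tendsto_const]) simp
  moreover have "norm_lp p (tl n) = r n powr (1/p)" for n
    by (simp add: norm_lp_def r_def sums_unique[OF tl_suminf, symmetric])
  ultimately have "(\<lambda>n. norm_lp p (tl n)) \<longlonglongrightarrow> 0" by simp
  then have "(\<lambda>n. \<bar>C\<bar> * (B * norm_lp p (tl n))) \<longlonglongrightarrow> \<bar>C\<bar> * (B * 0)" by (intro tendsto_mult tendsto_const)
  then have "\<bar>T (from_lp x) k - (\<Sum>i\<le>k. x i * z i k)\<bar> \<le> \<bar>C\<bar> * (B * 0)"
    by (rule LIMSEQ_le_const) (metis bound Suc_le_eq)
  then show ?thesis by simp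
qed

text \<open>On the coordinates of block \<open>j\<close> only \<open>z 0\<close> to
  \<open>z j\<close> can be nonzero, so the functionals produce exactly the triangular system that
  \<open>solve\<close> inverts.\<close>

lemma to_lp_T_from_lp:
  assumes "in_lp p x"
  shows "to_lp (T (from_lp x)) = x"
  unfolding to_lp_def
proof (rule solve_unique)
  fix j
  have "T (from_lp x) (fst q) = (\<Sum>i\<le>j. x i * z i (fst q))" if "q \<in> P j" for q
  proof -
    have q: "m j \<le> fst q" "fst q < m (Suc j)" using P_fst[of j] that by force+
    have "z i (fst q) = 0" if "i \<notin> {..j}" for i
      using m_Suc_le[of j i] q(2) that by (intro Ty_zero) auto
    then have "(\<Sum>i\<le>fst q. x i * z i (fst q)) = (\<Sum>i\<le>j. x i * z i (fst q))"
      using le_m[of j] q(1) by (intro sum.mono_neutral_right) auto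
    then show ?thesis by (simp add: T_from_lp[OF assms])
  qed
  then have "functional j (T (from_lp x)) = (\<Sum>q\<in>P j. \<Sum>i\<le>j. x i * (coef j q * (z i (fst q) / z j (fst q))))"
    unfolding functional_def by (intro sum.cong) (auto simp: sum_divide_distrib sum_distrib_left mult_ac)
  also have "\<dots> = (\<Sum>i\<le>j. functional j (z i) * x i)"
    unfolding functional_def by (subst sum.swap) (simp add: sum_distrib_left mult_ac)
  also have "\<dots> = x j + (\<Sum>i<j. functional j (z i) * x i)"
    by (simp add: lessThan_Suc_atMost[symmetric] functional_self)
  finally show "functional j (T (from_lp x)) = x j + (\<Sum>i<j. functional j (z i) * x i)" .
qed

text \<open>Inserting the factored identity between \<open>B\<close> and \<open>A\<close> exhibits
  \<open>S\<close> as a one-term sum, with left factor \<open>B\<close> after \<open>to_lp\<close>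
  and right factor \<open>from_lp\<close> after \<open>A\<close>.\<close>

lemma J_lp_subset: "J_lp w p \<subseteq> ideal_gen w p T"
proof
  fix S assume "S \<in> J_lp w p"
  then obtain A B where A: "bounded_op (in_dwp w p) (norm_dwp w p) (in_lp p) (norm_lp p) A"
    and B: "bounded_op (in_lp p) (norm_lp p) (in_dwp w p) (norm_dwp w p) B"
    and S: "\<forall>x. in_dwp w p x \<longrightarrow> S x = B (A x)" unfolding J_lp_def by (elim CollectE exE conjE)
  have "(\<lambda>x. B (to_lp x)) \<in> L_dwp w p"
    unfolding L_dwp_def using bounded_op_comp[OF bounded_op_to_lp B] by (simp add: norm_lp_def)
  moreover have "(\<lambda>x. from_lp (A x)) \<in> L_dwp w p"
    unfolding L_dwp_def using bounded_op_comp[OF A bounded_op_from_lp] by (simp add: norm_lp_def)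
  moreover have "S x = (\<lambda>k. B (to_lp (T (from_lp (A x)))) k)" if "in_dwp w p x" for x
    using S[rule_format, OF that] to_lp_T_from_lp[of "A x"] A that by (simp add: bounded_op_def)
  ultimately show "S \<in> ideal_gen w p T"
    unfolding ideal_gen_def
    by (intro CollectI exI[of _ 1] exI[of _ "\<lambda>_ x. B (to_lp x)"] exI[of _ "\<lambda>_ x. from_lp (A x)"]) simp
qed

end

subsection \<open>The gliding hump\<close>

text \<open>Iterate \<open>ex_block\<close> by dependent choice, starting each block where the
  previous one ends.\<close>

lemma (in fixing_operator) ex_blocks:
  obtains y m P K where "lorentz_blocks w p T y m P K"
proof -
  define \<delta> :: "nat \<Rightarrow> real" where "\<delta> j = 1 / (4 * (2 powr p) ^ (j + 2))" for j
  define good where "good n s \<longleftrightarrow> (case s of (m, m', y, P) \<Rightarrow> y \<in> Y_from m \<and> m < m' \<and>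
    norm_pow w p (T y) = 1 \<and> matching P \<and>
    fst ` P \<subseteq> {m..<m'} \<and> snd ` P \<subseteq> {m..<m'} \<and> 1/2 \<le> wsum w p P (T y) \<and> (\<forall>q\<in>P. T y (fst q) \<noteq> 0) \<and>
    (\<forall>Q. matching Q \<longrightarrow> fst ` Q \<subseteq> {m'..} \<longrightarrow> wsum w p Q y \<le> \<delta> n \<and> wsum w p Q (T y) \<le> \<delta> n))"
    for n and s :: "nat \<times> nat \<times> (nat \<Rightarrow> real) \<times> (nat \<times> nat) set"
  have ex: "\<exists>s. good n s \<and> fst s = a" for n a
  proof -
    have "0 < \<delta> n" by (simp add: \<delta>_def)
    from ex_block[OF this, of a] have "\<exists>y m' P. good n (a, m', y, P)" unfolding good_def prod.case by blast
    then show ?thesis by (metis fst_conv)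
  qed
  have "\<exists>f. \<forall>n. good n (f n) \<and> fst (f (Suc n)) = fst (snd (f n))"
    by (rule dependent_nat_choice) (use ex in blast)+
  then obtain f where f: "\<And>n. good n (f n)" "\<And>n. fst (f (Suc n)) = fst (snd (f n))" by blast
  define m where "m n = fst (f n)" for n
  define y where "y n = fst (snd (snd (f n)))" for n
  define P where "P n = snd (snd (snd (f n)))" for n
  have fn: "f n = (m n, m (Suc n), y n, P n)" for n by (simp add: m_def y_def P_def f(2))
  have g: "y n \<in> Y_from (m n)" "m n < m (Suc n)" "norm_pow w p (T (y n)) = 1" "matching (P n)"
    "fst ` P n \<subseteq> {m n..<m (Suc n)}" "snd ` P n \<subseteq> {m n..<m (Suc n)}" "1/2 \<le> wsum w p (P n) (T (y n))"
    "\<forall>q\<in>P n. T (y n) (fst q) \<noteq> 0"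
    "\<forall>Q. matching Q \<longrightarrow> fst ` Q \<subseteq> {m (Suc n)..} \<longrightarrow> wsum w p Q (y n) \<le> \<delta> n \<and> wsum w p Q (T (y n)) \<le> \<delta> n" for n
    by (insert f(1)[of n], unfold fn good_def prod.case, elim conjE, assumption)+
  have yY: "y n \<in> Y" for n using g(1) by (simp add: Y_from_def)
  \<comment> \<open>The images are normalized, so the lower bound of \<open>T\<close> on
    \<open>Y\<close> bounds the vectors themselves.\<close>
  have K: "norm_pow w p (y n) \<le> (1/c) powr p" for n
  proof -
    have "c * norm_dwp w p (y n) \<le> 1" using below[OF yY, of n] g(3)[of n] by (simp add: norm_dwp_eq)
    then have "norm_dwp w p (y n) \<le> 1/c" using c_pos by (simp add: field_simps)
    then show ?thesis unfolding norm_pow_eq[OF Y_dwp[OF yY]] using p_ge_1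
      by (intro powr_mono2) (auto simp: norm_dwp_def)
  qed
  have "lorentz_blocks w p T y m P ((1/c) powr p)"
  proof (unfold_locales)
    show "k < m j \<Longrightarrow> y j k = 0" "k < m j \<Longrightarrow> T (y j) k = 0" for j k
      using g(1)[of j] by (auto simp: Y_from_def)
    show "matching Q \<Longrightarrow> fst ` Q \<subseteq> {m (Suc j)..} \<Longrightarrow> wsum w p Q (y j) \<le> 1 / (4 * (2 powr p) ^ (j + 2))"
      "matching Q \<Longrightarrow> fst ` Q \<subseteq> {m (Suc j)..} \<Longrightarrow> wsum w p Q (T (y j)) \<le> 1 / (4 * (2 powr p) ^ (j + 2))" for Q j
      using g(9)[of j] by (auto simp: \<delta>_def)
  qed (use T Y_dwp[OF yY] K g in auto)
  then show ?thesis by (rule that)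
qed

theorem theorem3p1:
  fixes w :: "nat \<Rightarrow> real" and p :: real
    and T :: "(nat \<Rightarrow> real) \<Rightarrow> (nat \<Rightarrow> real)"
  assumes "1 \<le> p" and "lorentz_weight w"
    and "T \<in> L_dwp w p"
    and "\<not> strictly_singular_dwp w p T"
  shows "J_lp w p \<subseteq> ideal_gen w p T"
proof -
  from assms(4)[unfolded strictly_singular_dwp_def not_not]
  obtain Y c where Y: "closed_subspace_dwp w p Y" "infinite_dim Y" "c > 0"
    "\<forall>y\<in>Y. c * norm_dwp w p y \<le> norm_dwp w p (T y)"
    by (elim exE conjE)
  interpret fixing_operator w p T Y c
    by unfold_locales (use assms Y in auto)
  obtain y m P K where "lorentz_blocks w p T y m P K" by (rule ex_blocks)
  then show ?thesis by (rule lorentz_blocks.J_lp_subset)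
qed

end
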